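(* Let $f:\mathbb{R}_{\ge0}\to\mathbb{R}_{>0}$ be bounded and either (non-strictly) decreasing or continuous. Define $\tau(\xi)=-\dfrac{\log f(\xi)}{\log\xi}$ for $\xi>1$ and $\phi(\gamma)=-\log f(e^{\gamma})$ for $\gamma\in\mathbb{R}$. Then the three conditions $$\text{(a) }\limsup_{\xi\to+\infty}\frac{\xi^{-\alpha}}{f(\xi)}=0\ \forall\alpha>0,\qquad \text{(b) }\limsup_{\xi\to+\infty}\tau(\xi)=0,\qquad \text{(c) }\limsup_{\gamma\to+\infty}\frac{\phi(\gamma)}{\gamma}=0$$ are equivalent, and each implies $f\in\mathcal{F}(\mathbb{L})$. Likewise the three conditions $$\text{(a') }\exists\alpha_0>0:\ \liminf_{\xi\to+\infty}\frac{\xi^{-\alpha_0}}{f(\xi)}>0,\qquad \text{(b') }\liminf_{\xi\to+\infty}\tau(\xi)>0,\qquad \text{(c') }\liminf_{\gamma\to+\infty}\frac{\phi(\gamma)}{\gamma}>0$$ are equivalent, and each implies $f\notin\mathcal{F}(\mathbb{L})$.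
   Context: $\mathbb{L}=\{x\in\mathbb{R}\setminus\mathbb{Q}:\ \forall n\in\mathbb{N}\ \exists q\in\mathbb{N}\text{ with }\|qx\|<q^{-n}\}$ is the set of Liouville numbers, where $\|x\|=\min_{m\in\mathbb{Z}}|x-m|$. For a finite Borel measure $\mu$ on $\mathbb{R}$, $\hat\mu(\xi)=\int e^{-2\pi i x\xi}\,d\mu(x)$. For a Borel set $E\subset\mathbb{R}$, $\mathcal{P}(E)$ denotes the Borel probability measures $\mu$ on $\mathbb{R}$ with $\mu(\mathbb{R}\setminus E)=0$. For a function $f$ with values in $\mathbb{R}_{\ge0}$ defined at least on $[M_0,\infty)$ for some $M_0$, we write $f\in\mathcal{F}(E)$ if there exist $\mu\in\mathcal{P}(E)$ and constants $c,M>0$ such that $|\hat\mu(\xi)|\le c\,f(|\xi|)$ for all $\xi\in\mathbb{R}$ with $|\xi|\ge M$.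
   Formalization: In the definition of the Liouville numbers the integer q is required to satisfy q ≥ 2 (the standard definition); with q = 1 allowed, as written, every irrational would qualify and the claim f ∉ F(𝕃) would fail. *)

theory Defs
  imports "HOL-Probability.Probability"
begin

definition dist_int :: "real \<Rightarrow> real" where
  "dist_int x = (INF m\<in>(UNIV::int set). \<bar>x - of_int m\<bar>)"

definition Liouville_set :: "real set" where
  "Liouville_set = {x. x \<notin> \<rat> \<and>
     (\<forall>n::nat. \<exists>q::nat. q \<ge> 2 \<and> dist_int (real q * x) < inverse (real q ^ n))}"

definition fourier_meas :: "real measure \<Rightarrow> real \<Rightarrow> complex" where
  "fourier_meas \<mu> \<xi> = integral\<^sup>L \<mu> (\<lambda>x. cis (- 2 * pi * x * \<xi>))"

definition prob_on :: "real set \<Rightarrow> real measure set" where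
  "prob_on E = {\<mu>. prob_space \<mu> \<and> sets \<mu> = sets borel \<and> emeasure \<mu> (UNIV - E) = 0}"

definition decay_class :: "real set \<Rightarrow> (real \<Rightarrow> real) set" where
  "decay_class E = {f. \<exists>\<mu>\<in>prob_on E. \<exists>c>0. \<exists>M>0.
      \<forall>\<xi>. \<bar>\<xi>\<bar> \<ge> M \<longrightarrow> norm (fourier_meas \<mu> \<xi>) \<le> c * f \<bar>\<xi>\<bar>}"

end

theory Submission
  imports Defs
begin

text \<open>
  Both triples of conditions say how \<open>f\<close> compares with powers: the first that \<open>f\<close> eventually
  exceeds every negative power of \<open>\<xi>\<close>, the second that it is eventually below one of them.

  In the second case a measure whose Fourier transform is bounded by \<open>c f(|\<xi>|)\<close> satisfies
  \<open>\<mu>(I) \<le> K |I|\<^sup>\<beta>\<close> for some \<open>\<beta> > 0\<close> by Levy's inversion formula, so the coverings of the Liouville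
  numbers by the intervals of radius \<open>q\<^sup>-\<^sup>n\<close> around the fractions \<open>m/q\<close> show that they are a null set.

  In the first case take the law of \<open>X = \<Sum>n. p\<^sub>n / (q\<^sub>n R\<^sub>0 \<cdots> R\<^sub>n\<^sub>-\<^sub>1)\<close> with independent, uniformly
  distributed pairs \<open>(q\<^sub>n, p\<^sub>n)\<close>, where \<open>q\<^sub>n\<close> ranges over a short window and \<open>R\<^sub>n\<close> is a large power of
  the \<open>q\<^sub>n\<close>. The partial sums are rational with denominators much smaller than \<open>R\<^sub>n\<close>, so that \<open>X\<close> is a
  Liouville number. By independence the characteristic function of \<open>X\<close> is bounded by that of each
  single summand, which is an average of geometric sums over the \<open>q\<^sub>n\<close>; such a sum is large only
  if a multiple of \<open>q\<^sub>n\<close> is close to the rescaled frequency, and this happens for few \<open>q\<^sub>n\<close> because the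
  integers in a short window are nearly coprime. The stages can be spaced so widely that the
  resulting power decay, with exponent tending to \<open>0\<close>, is dominated by \<open>f\<close>.
\<close>

section \<open>Exponential sums over windows of denominators\<close>

lemma gcd_le_abs_diff:
  fixes a b :: nat
  assumes "a \<noteq> b"
  shows "gcd a b \<le> nat \<bar>int a - int b\<bar>"
proof -
  have "int (gcd a b) dvd int a - int b" by (intro dvd_diff) auto
  then have "int (gcd a b) \<le> \<bar>int a - int b\<bar>" using assms by (intro zdvd_imp_le) auto
  then show ?thesis by linarith
qed

text \<open>Taking the gcd with \<open>q\<close> is submultiplicative: \<open>gcd q (x * y)\<close>
  divides \<open>gcd q x * gcd q y\<close>. Hence each element of \<open>S\<close> contributes at
  most one factor \<open>H\<close>.\<close>

lemma gcd_Lcm_le: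
  fixes S :: "nat set"
  assumes "finite S" "\<And>x. x \<in> S \<Longrightarrow> gcd q x \<le> H" "H > 0" "q > 0"
  shows "gcd q (Lcm S) \<le> H ^ card S"
  using assms
proof (induction S rule: finite_induct)
  case (insert x S)
  have "gcd q (Lcm (insert x S)) dvd gcd q x * gcd q (Lcm S)"
  proof -
    have "Lcm (insert x S) dvd x * Lcm S" by simp
    then have "gcd q (Lcm (insert x S)) dvd gcd q (x * Lcm S)" by (meson gcd_dvd1 gcd_dvd2 dvd_trans gcd_greatest)
    also have "gcd q (x * Lcm S) dvd gcd q x * gcd q (Lcm S)"
    proof -
      have "gcd q (x * Lcm S) dvd gcd q x * Lcm S"
        using gcd_mult_distrib_nat[of "Lcm S" q x] by (auto simp: mult.commute)
      then have "gcd q (x * Lcm S) dvd gcd (gcd q x * q) (gcd q x * Lcm S)" by simp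
      then show ?thesis by (simp add: gcd_mult_distrib_nat)
    qed
    finally show ?thesis .
  qed
  then have "gcd q (Lcm (insert x S)) \<le> gcd q x * gcd q (Lcm S)"
    using \<open>q > 0\<close> by (intro dvd_imp_le) auto
  also have "\<dots> \<le> H * H ^ card S" using insert by (intro mult_mono) auto
  finally show ?case using insert by simp
qed auto

text \<open>Adjoining \<open>q\<close> to \<open>S\<close> multiplies the lcm by
  \<open>q / gcd q (Lcm S)\<close>. Distinct members of the window differ by less than
  \<open>H\<close>, so their gcds do not exceed \<open>H\<close>, and the loss is at most
  \<open>H ^ card S\<close>. The successive losses have exponents 0, 1, 2, ..., which add up to the
  triangular number.\<close>

lemma prod_le_Lcm_times_power:
  fixes S :: "nat set"
  assumes "finite S" "\<And>x. x \<in> S \<Longrightarrow> M \<le> x \<and> x < M + H" "M > 0"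
  shows "M ^ card S \<le> Lcm S * H ^ (card S * (card S - 1) div 2)"
  using assms
proof (induction S rule: finite_induct)
  case (insert q S)
  have q0: "q > 0" and H0: "H > 0" using insert.prems(1)[of q] insert.prems(2) by auto
  have g: "gcd q (Lcm S) \<le> H ^ card S"
  proof (rule gcd_Lcm_le)
    fix x assume x: "x \<in> S"
    then have "q \<noteq> x" using insert by auto
    then have "gcd q x \<le> nat \<bar>int q - int x\<bar>" by (rule gcd_le_abs_diff)
    also have "\<dots> \<le> H" using insert.prems(1)[of q] insert.prems(1)[of x] x by auto
    finally show "gcd q x \<le> H" .
  qed (use insert q0 H0 in auto)
  let ?c = "card S"
  have e: "Suc ?c * (Suc ?c - 1) div 2 = ?c * (?c - 1) div 2 + ?c"
    by (cases ?c) (auto simp: algebra_simps)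
  have "M ^ card (insert q S) = M ^ ?c * M" using insert by simp
  also have "\<dots> \<le> (Lcm S * H ^ (?c * (?c - 1) div 2)) * q"
    using insert by (intro mult_mono) auto
  also have "Lcm S * q = gcd q (Lcm S) * Lcm (insert q S)"
    using prod_gcd_lcm_nat[of q "Lcm S"] by (simp add: mult.commute)
  then have "(Lcm S * H ^ (?c * (?c - 1) div 2)) * q = gcd q (Lcm S) * Lcm (insert q S) * H ^ (?c * (?c - 1) div 2)"
    by (metis mult.commute mult.left_commute)
  also have "\<dots> \<le> H ^ ?c * Lcm (insert q S) * H ^ (?c * (?c - 1) div 2)"
    using g by (intro mult_right_mono) auto
  also have "\<dots> = Lcm (insert q S) * H ^ (Suc ?c * (Suc ?c - 1) div 2)"
    unfolding e by (simp add: power_add)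
  finally show ?case using insert by simp
qed auto

text \<open>
  The integers in a window of length \<open>b\<^sup>2\<close> are nearly coprime, so that \<open>r\<close> of them cannot have a
  small common multiple.
\<close>
lemma card_divisors_in_window:
  fixes b r m :: nat
  assumes "b \<ge> 2" "m > 0" "m < b ^ (r\<^sup>2 + r)"
  shows "card {q \<in> {b^(2*r)..<b^(2*r) + b\<^sup>2}. q dvd m} < r"
proof (rule ccontr)
  assume "\<not> ?thesis"
  then have "r \<le> card {q \<in> {b^(2*r)..<b^(2*r) + b\<^sup>2}. q dvd m}" by simp
  then obtain S where S: "S \<subseteq> {q \<in> {b^(2*r)..<b^(2*r) + b\<^sup>2}. q dvd m}" "card S = r" "finite S"
    by (meson obtain_subset_with_card_n)
  have "(b^(2*r)) ^ r \<le> Lcm S * (b\<^sup>2) ^ (r * (r - 1) div 2)"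
    using prod_le_Lcm_times_power[OF S(3), of "b^(2*r)" "b\<^sup>2"] S assms by auto
  also have "Lcm S \<le> m" using S assms by (intro dvd_imp_le Lcm_least) auto
  \<comment> \<open>The division by 2 is exact, because one of r and r - 1 is even.\<close>
  also have "(b\<^sup>2) ^ (r * (r - 1) div 2) = b ^ (r * (r - 1))"
    by (cases "even r") (simp_all flip: power_mult)
  \<comment> \<open>The bound on \<open>m\<close> is the one that makes the exponents match: (r^2 +
    r) + r (r - 1) = 2 r^2.\<close>
  finally have "b ^ (2 * r * r) \<le> m * b ^ (r * (r - 1))" by (simp flip: power_mult)
  also have "\<dots> < b ^ (r\<^sup>2 + r) * b ^ (r * (r - 1))" using assms by simp
  also have "\<dots> = b ^ (2 * r * r)"
    unfolding power_add[symmetric]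
    by (rule arg_cong[where f = "\<lambda>k. b ^ k"]) (cases r; simp add: algebra_simps power2_eq_square)
  finally show False by simp
qed

section \<open>Geometric sums of exponentials and distances to multiples of the denominator\<close>

lemma norm_sum_cis_le:
  fixes M :: nat
  assumes "cis x \<noteq> 1"
  shows "norm (\<Sum>p=1..M. cis (real p * x)) \<le> 2 / norm (1 - cis x)"
proof -
  have "(\<Sum>p=1..M. cis (real p * x)) = (\<Sum>p=1..M. cis x ^ p)" by (intro sum.cong refl) (simp only: Complex.DeMoivre)
  also have "\<dots> = cis x * (\<Sum>p<M. cis x ^ p)"
    by (simp add: sum_distrib_left sum.atLeast1_atMost_eq flip: power_Suc)
  also have "\<dots> = cis x * ((1 - cis x ^ M) / (1 - cis x))"
    using assms by (simp add: sum_gp_strict)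
  finally have "norm (\<Sum>p=1..M. cis (real p * x)) = norm (1 - cis x ^ M) / norm (1 - cis x)"
    by (simp add: norm_mult norm_divide)
  also have "\<dots> \<le> 2 / norm (1 - cis x)"
  proof (intro divide_right_mono)
    show "norm (1 - cis x ^ M) \<le> 2"
      using norm_triangle_ineq4[of 1 "cis x ^ M"] by (simp add: norm_power)
  qed auto
  finally show ?thesis .
qed

text \<open>A weak form of Jordan's inequality. The cubic Taylor bound gives sin y \<ge> y/3 for 0
  \<le> y \<le> 2, and \<pi> > 3 absorbs the factor 3.\<close>

lemma sin_pi_ge:
  assumes "0 \<le> x" "x \<le> 1/2"
  shows "sin (pi * x) \<ge> x"
proof -
  define y where "y = pi * x"
  have y: "0 \<le> y" "y \<le> 2"
    using assms pi_less_4 mult_mono[of pi 4 x "1/2"] by (auto simp: y_def)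
  have "\<bar>sin y - y\<bar> \<le> inverse (fact 3) * \<bar>y\<bar> ^ 3"
    using Maclaurin_sin_bound[of y 3] by (simp add: sin_coeff_def numeral_3_eq_3)
  then have "sin y \<ge> y - y * y\<^sup>2 / 6"
    using y unfolding abs_le_iff by (simp add: fact_numeral power2_eq_square power3_eq_cube field_simps)
  moreover have "y * y\<^sup>2 \<le> y * 4"
    using y power_mono[of y 2 2] by (intro mult_left_mono) auto
  ultimately have "sin y \<ge> y / 3" by simp
  moreover have "y \<ge> 3 * x" unfolding y_def using assms pi_gt3 by (intro mult_right_mono) auto
  ultimately show ?thesis by (simp add: y_def)
qed

text \<open>The chord has length 2 |sin (\<pi> y)|, where y is the signed distance of
  \<open>x\<close> from its nearest integer.\<close>

lemma norm_one_minus_cis_ge: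
  assumes "\<And>k::int. d \<le> \<bar>x - of_int k\<bar>"
  shows "2 * d \<le> norm (1 - cis (2 * pi * x))"
proof -
  define y where "y = x - of_int (round x)"
  have y: "\<bar>y\<bar> \<le> 1/2" using of_int_round_abs_le[of x] by (simp add: y_def abs_minus_commute)
  have "cis (2 * pi * x) = cis (2 * pi * y) * cis (2 * pi * of_int (round x))"
    by (simp add: cis_mult y_def algebra_simps)
  also have "cis (2 * pi * of_int (round x)) = 1" by (rule cis_multiple_2pi) auto
  finally have eq: "cis (2 * pi * x) = cis (2 * pi * y)" by simp
  have "(norm (1 - cis (2 * pi * y)))\<^sup>2 = (2 * \<bar>sin (pi * y)\<bar>)\<^sup>2"
  proof -
    have "(norm (1 - cis (2 * pi * y)))\<^sup>2 = (1 - cos (2 * pi * y))\<^sup>2 + (sin (2 * pi * y))\<^sup>2"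
      by (simp add: cmod_power2)
    also have "\<dots> = 2 - 2 * cos (2 * (pi * y))"
      using sin_cos_squared_add[of "2 * pi * y"] by (simp add: power2_eq_square algebra_simps)
    also have "\<dots> = (2 * \<bar>sin (pi * y)\<bar>)\<^sup>2"
      unfolding cos_double_sin by (simp add: power_mult_distrib)
    finally show ?thesis .
  qed
  then have n: "norm (1 - cis (2 * pi * y)) = 2 * \<bar>sin (pi * y)\<bar>"
    by (rule power2_eq_imp_eq) auto
  have "\<bar>y\<bar> \<le> sin (pi * \<bar>y\<bar>)" using y by (intro sin_pi_ge) auto
  also have "\<dots> \<le> \<bar>sin (pi * y)\<bar>" by (cases "y \<ge> 0") auto
  finally show ?thesis using assms[of "round x"] n eq by (simp add: y_def)
qed

lemma norm_sum_cis_frac_le: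
  fixes q M :: nat
  assumes "q > 0" "d > 0" "\<And>k::int. d \<le> \<bar>\<eta> - of_int k * real q\<bar>"
  shows "norm (\<Sum>p=1..M. cis (real p * (2 * pi * (\<eta> / real q)))) \<le> real q / d"
proof -
  have "d / real q \<le> \<bar>\<eta> / real q - of_int k\<bar>" for k :: int
  proof -
    have "\<eta> / real q - of_int k = (\<eta> - of_int k * real q) / real q"
      using assms(1) by (simp add: field_simps)
    then show ?thesis using assms by (simp add: divide_right_mono)
  qed
  then have 1: "2 * (d / real q) \<le> norm (1 - cis (2 * pi * (\<eta> / real q)))"
    by (rule norm_one_minus_cis_ge)
  have 2: "0 < 2 * (d / real q)" using assms by simp
  then have "cis (2 * pi * (\<eta> / real q)) \<noteq> 1" using 1 by auto
  then have "norm (\<Sum>p=1..M. cis (real p * (2 * pi * (\<eta> / real q))))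
      \<le> 2 / norm (1 - cis (2 * pi * (\<eta> / real q)))"
    by (rule norm_sum_cis_le)
  also have "\<dots> \<le> 2 / (2 * (d / real q))" using 1 2 by (intro frac_le) auto
  finally show ?thesis by simp
qed

text \<open>A \<open>q\<close> counted here divides one of the at most 3b integers within distance b
  of \<eta>. None of them is 0, because |\<eta>| \<ge> b, and all are small enough for
  \<open>card_divisors_in_window\<close> with r = 2u, so each accounts for fewer than 2u values of
  \<open>q\<close>.\<close>

lemma card_near_divisors_in_window:
  fixes b u :: nat and \<eta> :: real
  assumes b: "b \<ge> 2" and u: "u \<ge> 1"
    and lower: "b \<le> \<bar>\<eta>\<bar>" and upper: "\<bar>\<eta>\<bar> \<le> real b ^ (4 * u\<^sup>2)"
  shows "card {q \<in> {b^(4*u)..<b^(4*u) + b\<^sup>2}. \<exists>k::int. \<bar>\<eta> - of_int k * real q\<bar> < b} \<le> 6 * u * b"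
    (is "card ?C \<le> _")
proof -
  let ?Q = "{b^(4*u)..<b^(4*u) + b\<^sup>2}"
  define I where "I = {m::int. \<bar>\<eta> - of_int m\<bar> < b}"
  have I_sub: "I \<subseteq> {\<lceil>\<eta> - b\<rceil>..\<lfloor>\<eta> + b\<rfloor>}"
    unfolding I_def by auto linarith+
  then have fI: "finite I" by (rule finite_subset) simp
  have "card I \<le> card {\<lceil>\<eta> - b\<rceil>..\<lfloor>\<eta> + b\<rfloor>}" using I_sub by (intro card_mono) auto
  also have "\<dots> = nat (\<lfloor>\<eta> + b\<rfloor> - \<lceil>\<eta> - b\<rceil> + 1)" by simp
  also have "\<dots> \<le> 3 * b"
  proof -
    have "\<lfloor>\<eta> + b\<rfloor> - \<lceil>\<eta> - b\<rceil> \<le> 2 * int b" by linarith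
    then show ?thesis using b by linarith
  qed
  finally have cI: "card I \<le> 3 * b" .
  have few: "card {q \<in> ?Q. q dvd nat \<bar>m\<bar>} \<le> 2 * u" if "m \<in> I" for m
  proof -
    have m: "\<bar>\<eta> - of_int m\<bar> < b" using that by (simp add: I_def)
    then have "m \<noteq> 0" using lower by auto
    have "real_of_int \<bar>m\<bar> < real b ^ (4 * u\<^sup>2) + b" using m upper by linarith
    also have "\<dots> \<le> real b ^ (4 * u\<^sup>2) + real b ^ (4 * u\<^sup>2)"
      using b u by (intro add_left_mono self_le_power) auto
    also have "\<dots> \<le> real b ^ (4 * u\<^sup>2) * real b ^ 1" using b by (simp add: mult_left_mono)
    also have "\<dots> \<le> real b ^ (4 * u\<^sup>2) * real b ^ (2 * u)"
      using b u by (intro mult_left_mono power_increasing) auto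
    also have "\<dots> = real_of_int (int (b ^ ((2 * u)\<^sup>2 + 2 * u)))"
      by (simp add: power_add power_mult_distrib)
    finally have "\<bar>m\<bar> < int (b ^ ((2 * u)\<^sup>2 + 2 * u))" by linarith
    then have "nat \<bar>m\<bar> < b ^ ((2 * u)\<^sup>2 + 2 * u)" by linarith
    with card_divisors_in_window[of b "nat \<bar>m\<bar>" "2 * u"] b \<open>m \<noteq> 0\<close>
    show ?thesis by simp
  qed
  have "?C \<subseteq> (\<Union>m\<in>I. {q \<in> ?Q. q dvd nat \<bar>m\<bar>})"
  proof
    fix q assume "q \<in> ?C"
    then obtain k :: int where q: "q \<in> ?Q" and k: "\<bar>\<eta> - of_int k * real q\<bar> < b" by auto
    have "k * int q \<in> I" using k by (simp add: I_def)
    moreover have "q dvd nat \<bar>k * int q\<bar>" by (simp add: abs_mult nat_mult_distrib)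
    ultimately show "q \<in> (\<Union>m\<in>I. {q \<in> ?Q. q dvd nat \<bar>m\<bar>})" using q by blast
  qed
  then have "card ?C \<le> card (\<Union>m\<in>I. {q \<in> ?Q. q dvd nat \<bar>m\<bar>})"
    using fI by (intro card_mono) auto
  also have "\<dots> \<le> (\<Sum>m\<in>I. card {q \<in> ?Q. q dvd nat \<bar>m\<bar>})" using fI by (rule card_UN_le)
  also have "\<dots> \<le> of_nat (card I) * (2 * u)" using few by (rule sum_bounded_above)
  also have "\<dots> \<le> 3 * b * (2 * u)" using cI by simp
  finally show ?thesis by (simp add: ac_simps)
qed

text \<open>For |\<eta>| \<le> M/2 every multiple of every \<open>q\<close> is at distance at least
  |\<eta>| from \<eta>, so all inner sums are at most 2M/|\<eta>|. For larger |\<eta>| the inner sum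
  is at most 2M/b outside an exceptional set of at most 6ub denominators, where the trivial bound M
  is used. Relative to the b^2 M terms of the double sum both contributions are of order
  1/b.\<close>

lemma window_exponential_sum_bound:
  fixes b u :: nat and \<eta> :: real
  defines "M \<equiv> b ^ (4 * u)"
  assumes b: "b \<ge> 2" and u: "u \<ge> 1"
    and lower: "1 \<le> \<bar>\<eta>\<bar>" and upper: "\<bar>\<eta>\<bar> \<le> real b ^ (4 * u\<^sup>2)"
  shows "norm (\<Sum>q\<in>{M..<M + b\<^sup>2}. \<Sum>p=1..M. cis (real p * (2 * pi * (\<eta> / real q))))
    \<le> real (b\<^sup>2 * M) * ((2 + 6 * u) * \<bar>\<eta>\<bar> powr (-(1 / (4 * u\<^sup>2))))"
proof -
  define \<delta> where "\<delta> = 1 / (4 * real u ^ 2)"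
  have "1 \<le> real u ^ 2" using u by (intro one_le_power) simp
  then have "0 < 4 * real u ^ 2" "1 \<le> 4 * real u ^ 2" by linarith+
  then have \<delta>: "0 < \<delta>" "\<delta> \<le> 1" unfolding \<delta>_def by (simp, simp only: divide_le_eq_1_pos)
  define F where "F = (\<lambda>q::nat. norm (\<Sum>p=1..M. cis (real p * (2 * pi * (\<eta> / real q)))))"
  \<comment> \<open>This keeps the window inside [M, 2M], and it yields b \<le> |\<eta>| when
    |\<eta>| > M/2.\<close>
  have Mb: "b\<^sup>2 * 2 \<le> M"
  proof -
    have "b\<^sup>2 * 2 \<le> b\<^sup>2 * b\<^sup>2" using b self_le_power[of b 2] by (intro mult_left_mono) auto
    also have "\<dots> = b ^ 4" by (simp flip: power_add)
    also have "\<dots> \<le> M" unfolding M_def using b u by (intro power_increasing) auto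
    finally show ?thesis .
  qed
  have M0: "M > 0" using b by (simp add: M_def)
  have bb: "b \<le> b\<^sup>2" using b by (simp add: power2_eq_square)
  have trivial: "F q \<le> M" for q
  proof -
    have "F q \<le> (\<Sum>p=1..M. norm (cis (real p * (2 * pi * (\<eta> / real q)))))"
      unfolding F_def by (rule norm_sum)
    then show ?thesis by simp
  qed
  have "norm (\<Sum>q\<in>{M..<M + b\<^sup>2}. \<Sum>p=1..M. cis (real p * (2 * pi * (\<eta> / real q))))
      \<le> (\<Sum>q\<in>{M..<M + b\<^sup>2}. F q)" unfolding F_def by (rule norm_sum)
  also have "\<dots> \<le> real (b\<^sup>2 * M) * ((2 + 6 * u) * \<bar>\<eta>\<bar> powr (-\<delta>))"
  proof (cases "\<bar>\<eta>\<bar> \<le> M / 2")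
    case True
    have "F q \<le> 2 * M / \<bar>\<eta>\<bar>" if q: "q \<in> {M..<M + b\<^sup>2}" for q
    proof -
      have "\<bar>\<eta>\<bar> \<le> \<bar>\<eta> - of_int k * real q\<bar>" for k :: int
      proof (cases "k = 0")
        case False
        then have "1 * real q \<le> \<bar>of_int k\<bar> * real q" by (intro mult_right_mono) auto
        then have "real M \<le> \<bar>of_int k * real q\<bar>" using q by (simp add: abs_mult)
        then show ?thesis using True by linarith
      qed simp
      then have "F q \<le> real q / \<bar>\<eta>\<bar>"
        unfolding F_def using lower q M0 by (intro norm_sum_cis_frac_le) auto
      also have "\<dots> \<le> (2 * M) / \<bar>\<eta>\<bar>" using q Mb by (intro divide_right_mono) auto
      finally show ?thesis .
    qed
    then have "(\<Sum>q\<in>{M..<M + b\<^sup>2}. F q) \<le> of_nat (card {M..<M + b\<^sup>2}) * (2 * M / \<bar>\<eta>\<bar>)"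
      by (rule sum_bounded_above)
    also have "\<dots> = real (b\<^sup>2 * M) * (2 * \<bar>\<eta>\<bar> powr (-1))"
      using lower by (simp add: powr_minus_divide)
    also have "\<dots> \<le> real (b\<^sup>2 * M) * ((2 + 6 * u) * \<bar>\<eta>\<bar> powr (-\<delta>))"
      using lower \<delta> by (intro mult_left_mono mult_mono powr_mono) auto
    finally show ?thesis .
  next
    case False
    let ?C = "{q \<in> {M..<M + b\<^sup>2}. \<exists>k::int. \<bar>\<eta> - of_int k * real q\<bar> < b}"
    have "real b \<le> \<bar>\<eta>\<bar>"
    proof -
      have "b * 2 \<le> M" using Mb bb by linarith
      then show ?thesis using False by linarith
    qed
    then have C: "card ?C \<le> 6 * u * b"
      unfolding M_def using b u upper by (intro card_near_divisors_in_window) auto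
    have far: "F q \<le> 2 * M / b" if q: "q \<in> {M..<M + b\<^sup>2} - ?C" for q
    proof -
      have "F q \<le> real q / b"
        unfolding F_def using b q M0 by (intro norm_sum_cis_frac_le) (auto simp: not_less)
      also have "\<dots> \<le> (2 * M) / b" using q Mb by (intro divide_right_mono) auto
      finally show ?thesis .
    qed
    have "(\<Sum>q\<in>{M..<M + b\<^sup>2}. F q) = (\<Sum>q\<in>{M..<M + b\<^sup>2} - ?C. F q) + (\<Sum>q\<in>?C. F q)"
      by (rule sum.subset_diff) auto
    also have "\<dots> \<le> real (card ({M..<M + b\<^sup>2} - ?C)) * (2 * M / b) + real (card ?C) * real M"
      using far trivial by (intro add_mono sum_bounded_above)
    also have "\<dots> \<le> real (b\<^sup>2) * (2 * M / b) + real (6 * u * b) * real M"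
    proof (intro add_mono mult_right_mono)
      have "card ({M..<M + b\<^sup>2} - ?C) \<le> card {M..<M + b\<^sup>2}" by (intro card_mono) auto
      then show "real (card ({M..<M + b\<^sup>2} - ?C)) \<le> real (b\<^sup>2)" by simp
      show "real (card ?C) \<le> real (6 * u * b)" using C by linarith
    qed auto
    also have "\<dots> = real (b\<^sup>2 * M) * ((2 + 6 * u) * (1 / b))"
      using b by (simp add: field_simps power2_eq_square)
    \<comment> \<open>The exponent \<delta> is dictated by the largest admissible frequency,
      \<open>b ^ (4 * u\<^sup>2)\<close>, at which |\<eta>|^\<delta> reaches b.\<close>
    also have "1 / b \<le> \<bar>\<eta>\<bar> powr (-\<delta>)"
    proof -
      have "\<bar>\<eta>\<bar> powr \<delta> \<le> (real b ^ (4 * u\<^sup>2)) powr \<delta>"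
        using upper \<delta> by (intro powr_mono2) auto
      also have "\<dots> = real b powr (real (4 * u\<^sup>2) * \<delta>)"
        using b by (simp add: powr_powr flip: powr_realpow)
      also have "real (4 * u\<^sup>2) * \<delta> = 1" using u by (simp add: \<delta>_def)
      finally have "\<bar>\<eta>\<bar> powr \<delta> \<le> b" using b by simp
      then show ?thesis using lower b by (auto simp: powr_minus_divide intro!: divide_left_mono)
    qed
    finally show ?thesis by (simp add: mult_left_mono)
  qed
  finally show ?thesis by (simp add: \<delta>_def)
qed

section \<open>Liouville numbers\<close>

lemma dist_int_less_iff: "dist_int x < c \<longleftrightarrow> (\<exists>m::int. \<bar>x - of_int m\<bar> < c)"
  unfolding dist_int_def by (subst cINF_less_iff) (auto intro!: bdd_belowI[of _ 0])

text \<open>Irrationality follows from the approximations being inexact. If x = a/c, a nonzero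
  \<open>D * x - m\<close> has absolute value at least 1/c, whereas the hypothesis for n = c makes
  it smaller than 2^(-c) < 1/c.\<close>

lemma Liouville_set_memI:
  assumes "\<And>n::nat. \<exists>(D::nat) (m::int). D \<ge> 2 \<and> 0 < \<bar>real D * x - of_int m\<bar>
             \<and> \<bar>real D * x - of_int m\<bar> < inverse (real D ^ n)"
  shows "x \<in> Liouville_set"
proof -
  have "x \<notin> \<rat>"
  proof
    assume "x \<in> \<rat>"
    then obtain a :: int and c :: nat where c: "c \<noteq> 0" and x: "x = of_int a / real c"
      by (auto simp: Rats_eq_int_div_nat)
    obtain D :: nat and m :: int where D: "D \<ge> 2" and pos: "0 < \<bar>real D * x - of_int m\<bar>"
      and less: "\<bar>real D * x - of_int m\<bar> < inverse (real D ^ c)"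
      using assms[of c] by blast
    have eq: "real D * x - of_int m = of_int (int D * a - m * int c) / real c"
      using c by (simp add: x field_simps)
    then have "int D * a - m * int c \<noteq> 0" using pos by (metis abs_zero div_0 of_int_0 less_irrefl)
    then have "1 \<le> \<bar>int D * a - m * int c\<bar>" by linarith
    then have "1 \<le> real_of_int \<bar>int D * a - m * int c\<bar>" by linarith
    then have "1 / real c \<le> \<bar>real D * x - of_int m\<bar>"
      unfolding eq abs_divide by (simp add: divide_right_mono)
    also note less
    also have "inverse (real D ^ c) \<le> inverse (2 ^ c)"
      using D by (intro le_imp_inverse_le power_mono) auto
    also have "\<dots> < inverse (real c)"
      using c less_exp[of c] by (intro less_imp_inverse_less) (auto simp: of_nat_less_numeral_power_cancel_iff)
    finally show False by (simp add: inverse_eq_divide)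
  qed
  moreover have "\<exists>q::nat. q \<ge> 2 \<and> dist_int (real q * x) < inverse (real q ^ n)" for n
    using assms[of n] unfolding dist_int_less_iff by blast
  ultimately show ?thesis by (simp add: Liouville_set_def)
qed

lemma Liouville_set_borel [measurable]: "Liouville_set \<in> sets borel"
proof -
  have eq: "Liouville_set = (\<Inter>n. \<Union>q\<in>{2..}. \<Union>m::int. {x. \<bar>real q * x - of_int m\<bar> < inverse (real q ^ n)}) - \<rat>"
    unfolding Liouville_set_def dist_int_less_iff by (auto simp: Bex_def)
  have "open {x. \<bar>real q * x - of_int m\<bar> < inverse (real q ^ n)}" for q n :: nat and m :: int
    by (intro open_Collect_less continuous_intros)
  then have "(\<Union>q\<in>{2..}. \<Union>m::int. {x. \<bar>real q * x - of_int m\<bar> < inverse (real q ^ n)}) \<in> sets borel"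
    for n :: nat
    by (intro borel_open open_UN ballI)
  then have "(\<Inter>n. \<Union>q\<in>{2..}. \<Union>m::int. {x. \<bar>real q * x - of_int m\<bar> < inverse (real q ^ n)}) \<in> sets borel"
    by (intro sets.countable_INT) auto
  moreover have "(\<rat> :: real set) \<in> sets borel"
    by (rule sets.countable[OF _ countable_rat]) simp
  ultimately show ?thesis unfolding eq by (rule sets.Diff)
qed

section \<open>Random Liouville numbers with slowly decaying Fourier transform\<close>

text \<open>
  The parameters of stage \<open>n\<close> are balanced as follows. The partial sum has denominator at most
  \<open>b\<^sup>5\<^sup>u\<close>, whose power \<open>n + 1\<close> must stay below \<open>R = b\<^sup>2\<^sup>u\<^sup>u\<close>; on the other hand the exponential sum
  bound is available up to \<open>b\<^sup>4\<^sup>u\<^sup>u = R\<^sup>2\<close>, which makes the frequency ranges of consecutive stages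
  overlap.
\<close>
locale liouville_series =
  fixes b :: "nat \<Rightarrow> nat" and u M R P :: "nat \<Rightarrow> nat"
  defines "u \<equiv> \<lambda>n. 3 * Suc n"
    and "M \<equiv> \<lambda>n. b n ^ (4 * u n)"
    and "R \<equiv> \<lambda>n. b n ^ (2 * (u n)\<^sup>2)"
    and "P \<equiv> \<lambda>n. \<Prod>k<n. R k"
  assumes b_ge_2: "b n \<ge> 2"
    and b_growth: "2 * (\<Prod>k<n. 2 * M k * R k) \<le> b n"
begin

text \<open>The numerator runs up to \<open>M n\<close> rather than up to the chosen denominator.
  This makes the set a product, so that the uniform law turns into the double sum of
  \<open>window_exponential_sum_bound\<close>; the numerator still never exceeds the
  denominator.\<close>

definition pairs :: "nat \<Rightarrow> (nat \<times> nat) set" where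
  "pairs n = {M n..<M n + (b n)\<^sup>2} \<times> {1..M n}"

definition summand :: "nat \<Rightarrow> nat \<times> nat \<Rightarrow> real" where
  "summand n z = real (snd z) / (real (fst z) * real (P n))"

definition series :: "(nat \<Rightarrow> nat \<times> nat) \<Rightarrow> real" where
  "series \<omega> = (\<Sum>n. summand n (\<omega> n))"

lemma u_pos: "u n \<ge> 1" by (simp add: u_def)

lemma M_pos: "M n > 0" using b_ge_2[of n] by (simp add: M_def)

lemma b_le_M: "b n \<le> M n" unfolding M_def using b_ge_2[of n] u_pos[of n] by (intro self_le_power) auto

lemma b_le_R: "b n \<le> R n" unfolding R_def using b_ge_2[of n] u_pos[of n] by (intro self_le_power) auto

lemma R_ge_2: "R n \<ge> 2" using b_le_R[of n] b_ge_2[of n] by simp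

lemma square_b_le_M: "(b n)\<^sup>2 \<le> M n"
  unfolding M_def using b_ge_2[of n] u_pos[of n] by (intro power_increasing) auto

lemma P_Suc: "P (Suc n) = P n * R n" by (simp add: P_def)

lemma P_pos: "P n > 0"
proof -
  have "R k > 0" for k using R_ge_2[of k] by simp
  then show ?thesis by (simp add: P_def prod_pos)
qed

lemma P_growth: "P n * 2 ^ k \<le> P (n + k)"
proof (induction k)
  case (Suc k)
  have "P n * 2 ^ Suc k = (P n * 2 ^ k) * 2" by simp
  also have "\<dots> \<le> P (n + k) * R (n + k)" using Suc R_ge_2[of "n + k"] by (intro mult_mono) auto
  finally show ?case by (simp add: P_Suc)
qed simp

lemma P_dvd: "k \<le> n \<Longrightarrow> P k dvd P n"
  unfolding P_def by (intro prod_dvd_prod_subset) auto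

lemma P_le_b: "P n \<le> b n"
proof -
  have "P n \<le> (\<Prod>k<n. 2 * M k * R k)"
    unfolding P_def using M_pos by (intro prod_mono) (auto simp: Suc_le_eq)
  then show ?thesis using b_growth[of n] by simp
qed

lemma finite_pairs: "finite (pairs n)" by (simp add: pairs_def)

lemma card_pairs: "card (pairs n) = (b n)\<^sup>2 * M n" by (simp add: pairs_def)

lemma pairs_nonempty: "pairs n \<noteq> {}"
  using card_pairs[of n] M_pos[of n] b_ge_2[of n] by auto

lemma pairs_bounds:
  assumes "z \<in> pairs n"
  shows "M n \<le> fst z" "fst z \<le> 2 * M n" "1 \<le> snd z" "snd z \<le> fst z"
  using assms square_b_le_M[of n] by (auto simp: pairs_def)

lemma summand_bounds:
  assumes "z \<in> pairs n"
  shows "0 < summand n z" "summand n z \<le> 1 / P n"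
proof -
  have z: "0 < real (snd z)" "real (snd z) \<le> real (fst z)" using pairs_bounds[OF assms] by auto
  then show "0 < summand n z" using P_pos[of n] by (simp add: summand_def)
  have "summand n z = (real (snd z) / real (fst z)) / P n" by (simp add: summand_def)
  also have "\<dots> \<le> 1 / P n" using z by (intro divide_right_mono) auto
  finally show "summand n z \<le> 1 / P n" .
qed

lemma inverse_P_le: "1 / real (P (n + k)) \<le> 1 / P n * (1/2) ^ k"
proof -
  have "1 / real (P (n + k)) \<le> 1 / real (P n * 2 ^ k)"
    using P_growth[of n k] P_pos[of n] P_pos[of "n + k"] by (intro divide_left_mono of_nat_mono mult_pos_pos) auto
  then show ?thesis by (simp add: power_divide)
qed

lemma summable_summands:
  assumes "\<And>k. \<omega> k \<in> pairs k"
  shows "summable (\<lambda>k. summand (n + k) (\<omega> (n + k)))"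
proof (rule summable_comparison_test_ev)
  show "\<forall>\<^sub>F k in sequentially. norm (summand (n + k) (\<omega> (n + k))) \<le> 1 / P n * (1/2) ^ k"
  proof (intro always_eventually allI)
    fix k
    show "norm (summand (n + k) (\<omega> (n + k))) \<le> 1 / P n * (1/2) ^ k"
      using summand_bounds[OF assms[of "n + k"]] inverse_P_le[of n k] by simp
  qed
  show "summable (\<lambda>k. 1 / real (P n) * (1/2) ^ k)" by (intro summable_mult summable_geometric) simp
qed

text \<open>Comparison with a geometric series. Strict positivity is needed as much as the upper
  bound: it makes the rational approximations of the series inexact.\<close>

lemma tail_bounds:
  assumes "\<And>k. \<omega> k \<in> pairs k"
  shows "0 < (\<Sum>k. summand (n + k) (\<omega> (n + k)))" "(\<Sum>k. summand (n + k) (\<omega> (n + k))) \<le> 2 / P n"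
proof -
  show "0 < (\<Sum>k. summand (n + k) (\<omega> (n + k)))"
    using summand_bounds(1)[OF assms] by (intro suminf_pos summable_summands assms) auto
  have "(\<Sum>k. summand (n + k) (\<omega> (n + k))) \<le> (\<Sum>k. 1 / P n * (1/2) ^ k)"
  proof (intro suminf_le summable_summands assms summable_mult summable_geometric)
    show "summand (n + k) (\<omega> (n + k)) \<le> 1 / P n * (1/2) ^ k" for k
      using summand_bounds[OF assms[of "n + k"]] inverse_P_le[of n k] by simp
  qed simp
  also have "\<dots> = 1 / P n * (\<Sum>k. (1/2) ^ k)" by (intro suminf_mult summable_geometric) simp
  also have "\<dots> = 2 / P n" by (subst suminf_geometric) auto
  finally show "(\<Sum>k. summand (n + k) (\<omega> (n + k))) \<le> 2 / P n" .
qed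

lemma partial_sum_denominator:
  assumes "\<And>k. \<omega> k \<in> pairs k"
  shows "\<exists>m::int. real ((\<Prod>k\<le>n. fst (\<omega> k)) * P n) * (\<Sum>k\<le>n. summand k (\<omega> k)) = of_int m"
proof -
  define D where "D = (\<Prod>k\<le>n. fst (\<omega> k)) * P n"
  have "real D * (\<Sum>k\<le>n. summand k (\<omega> k)) \<in> \<int>"
    unfolding sum_distrib_left
  proof (rule Ints_sum)
    fix k assume k: "k \<in> {..n}"
    have "fst (\<omega> k) dvd (\<Prod>k\<le>n. fst (\<omega> k))" using k by (intro dvd_prodI) auto
    moreover have "P k dvd P n" using k by (intro P_dvd) auto
    ultimately have "fst (\<omega> k) * P k dvd D" unfolding D_def by (rule mult_dvd_mono)
    then obtain c where c: "D = fst (\<omega> k) * P k * c" by blast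
    have "fst (\<omega> k) \<noteq> 0" "P k \<noteq> 0" using pairs_bounds[OF assms[of k]] P_pos[of k] by auto
    then have "real D * summand k (\<omega> k) = real (c * snd (\<omega> k))"
      by (simp add: summand_def c)
    then show "real D * summand k (\<omega> k) \<in> \<int>" by simp
  qed
  then show ?thesis unfolding D_def by (auto elim: Ints_cases)
qed

text \<open>By \<open>b_growth\<close>, everything in \<open>D\<close> except a factor
  \<open>M n\<close> is at most \<open>b n\<close>, so \<open>D\<close> is at most
  \<open>b n ^ (5 * u n)\<close>. The exponent \<open>Suc n\<close> leaves one power of
  \<open>D\<close> to spare for clearing denominators.\<close>

lemma denominator_bounds:
  fixes n :: nat
  assumes "\<And>k. \<omega> k \<in> pairs k"
  defines "D \<equiv> (\<Prod>k\<le>n. fst (\<omega> k)) * P n"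
  shows "2 \<le> D" "2 * D ^ Suc n < R n"
proof -
  have "0 < fst (\<omega> k)" for k using pairs_bounds[OF assms(1)[of k]] by auto
  define e where "e = (\<Prod>k<n. fst (\<omega> k)) * P n"
  have "0 < e" using \<open>\<And>k. 0 < fst (\<omega> k)\<close> P_pos by (simp add: e_def prod_pos)
  then have "fst (\<omega> n) * 1 \<le> fst (\<omega> n) * e" by (intro mult_left_mono) auto
  also have "\<dots> = D" by (simp add: D_def e_def flip: lessThan_Suc_atMost)
  finally show "2 \<le> D"
    using pairs_bounds[OF assms(1)[of n]] b_le_M[of n] b_ge_2[of n] by linarith
  have "D \<le> (\<Prod>k\<le>n. 2 * M k) * P n"
    unfolding D_def using pairs_bounds(2)[OF assms(1)] by (intro mult_right_mono prod_mono) auto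
  also have "\<dots> = 2 * (\<Prod>k<n. 2 * M k * R k) * M n"
    by (simp add: P_def prod.distrib ac_simps flip: lessThan_Suc_atMost)
  also have "\<dots> \<le> b n * M n" using b_growth[of n] by (rule mult_right_mono) simp
  also have "\<dots> \<le> b n ^ (5 * u n)"
  proof -
    have "b n * M n = b n ^ (4 * u n + 1)" by (simp add: M_def)
    also have "\<dots> \<le> b n ^ (5 * u n)" using b_ge_2[of n] u_pos[of n] by (intro power_increasing) auto
    finally show ?thesis .
  qed
  finally have "D ^ Suc n \<le> (b n ^ (5 * u n)) ^ Suc n" by (rule power_mono) simp
  then have "2 * D ^ Suc n \<le> b n * (b n ^ (5 * u n)) ^ Suc n"
    using b_ge_2[of n] by (intro mult_mono) auto
  also have "\<dots> = b n ^ (1 + 5 * u n * Suc n)" by (simp add: power_add flip: power_mult)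
  also have "\<dots> < R n"
    unfolding R_def
  proof (rule power_strict_increasing)
    \<comment> \<open>This fixes the factor 3 in \<open>u n\<close>: the claim reads 1 + 15 (n +
      1)^2 < 18 (n + 1)^2.\<close>
    show "1 + 5 * u n * Suc n < 2 * (u n)\<^sup>2" by (simp add: u_def power2_eq_square algebra_simps)
  qed (use b_ge_2[of n] in simp)
  finally show "2 * D ^ Suc n < R n" .
qed

text \<open>The partial sum up to stage n equals m/D, and the tail is positive and at most 2/R_n <
  1/D^(n+1). Multiplying by D gives the approximation of order n.\<close>

lemma series_in_Liouville_set:
  assumes "\<And>k. \<omega> k \<in> pairs k"
  shows "series \<omega> \<in> Liouville_set"
proof (rule Liouville_set_memI)
  fix n
  define D where "D = (\<Prod>k\<le>n. fst (\<omega> k)) * P n"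
  have D: "2 \<le> D" "2 * D ^ Suc n < R n"
    using denominator_bounds[of \<omega> n] assms by (auto simp: D_def)
  define T where "T = (\<Sum>k. summand (Suc n + k) (\<omega> (Suc n + k)))"
  obtain m :: int where m: "real D * (\<Sum>k\<le>n. summand k (\<omega> k)) = of_int m"
    using partial_sum_denominator[of \<omega> n] assms by (auto simp: D_def)
  have "series \<omega> = T + (\<Sum>k\<le>n. summand k (\<omega> k))"
    unfolding series_def T_def
    using suminf_split_initial_segment[OF summable_summands[of \<omega> 0, OF assms, simplified], of "Suc n"]
    by (simp add: lessThan_Suc_atMost add.commute)
  then have eq: "real D * series \<omega> - of_int m = real D * T" using m by (simp add: algebra_simps)
  have T: "0 < T" "T \<le> 2 / P (Suc n)"
    using tail_bounds[of \<omega> "Suc n"] assms unfolding T_def by auto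
  have "T \<le> 2 / R n"
  proof -
    have "R n \<le> P (Suc n)" using mult_le_mono1[of 1 "P n" "R n"] P_pos[of n] by (simp add: P_Suc)
    then have "2 / real (P (Suc n)) \<le> 2 / R n" using R_ge_2[of n] by (intro frac_le) auto
    then show ?thesis using T by simp
  qed
  also have "\<dots> < 2 / (2 * real D ^ Suc n)"
  proof (rule divide_strict_left_mono)
    have "real (2 * D ^ Suc n) < real (R n)" using D(2) of_nat_less_iff by blast
    then show "2 * real D ^ Suc n < real (R n)" by simp
  qed (use D(1) R_ge_2[of n] in auto)
  finally have "real D * T < real D * (2 / (2 * real D ^ Suc n))" using D(1) by (intro mult_strict_left_mono) auto
  also have "\<dots> = inverse (real D ^ n)" using D(1) by (simp add: field_simps)
  finally have "\<bar>real D * series \<omega> - of_int m\<bar> < inverse (real D ^ n)" using T(1) eq by simp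
  moreover have "0 < \<bar>real D * series \<omega> - of_int m\<bar>" using T(1) D(1) eq by simp
  ultimately show "\<exists>(D::nat) (m::int). D \<ge> 2 \<and> 0 < \<bar>real D * series \<omega> - of_int m\<bar>
             \<and> \<bar>real D * series \<omega> - of_int m\<bar> < inverse (real D ^ n)"
    using D(1) by blast
qed

end

text \<open>Independence means that the joint law is the product of the marginals. The joint map of
  all coordinates is the identity on the product space, and its marginals are the factors.\<close>

lemma indep_vars_PiM_coordinates:
  assumes "\<And>i. prob_space (N i)" "I \<noteq> {}"
  shows "prob_space.indep_vars (PiM I N) N (\<lambda>i \<omega>. \<omega> i) I"
proof -
  interpret product_prob_space N I
    by (intro product_prob_spaceI assms)
  have "distr (PiM I N) (PiM I N) (\<lambda>x. \<lambda>i\<in>I. x i) = distr (PiM I N) (PiM I N) (\<lambda>x. x)"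
    by (intro distr_cong) (auto simp: space_PiM PiE_iff extensional_restrict)
  also have "\<dots> = PiM I N" by (rule distr_id)
  also have "\<dots> = PiM I (\<lambda>i. distr (PiM I N) (N i) (\<lambda>x. x i))"
    by (intro PiM_cong refl) (simp add: PiM_component)
  finally show ?thesis
    using assms(2) by (subst indep_vars_iff_distr_eq_PiM') auto
qed

lemma fourier_meas_eq_char: "fourier_meas \<mu> \<xi> = char \<mu> (- 2 * pi * \<xi>)"
  unfolding fourier_meas_def char_def cis_conv_exp by (intro Bochner_Integration.integral_cong) (auto simp: ac_simps)

section \<open>The law of the random series and its Fourier transform\<close>

context liouville_series
begin

definition sample_space :: "(nat \<Rightarrow> nat \<times> nat) measure" where
  "sample_space = PiM UNIV (\<lambda>n. uniform_count_measure (pairs n))"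

definition law :: "real measure" where
  "law = distr sample_space borel series"

lemma prob_space_pairs: "prob_space (uniform_count_measure (pairs n))"
  by (intro prob_space_uniform_count_measure finite_pairs pairs_nonempty)

lemma prob_space_sample_space: "prob_space sample_space"
  unfolding sample_space_def by (intro prob_space_PiM prob_space_pairs)

lemma space_sample_space: "\<omega> \<in> space sample_space \<Longrightarrow> \<omega> n \<in> pairs n"
  by (auto simp: sample_space_def space_PiM space_uniform_count_measure)

lemma measurable_pairs: "f \<in> borel_measurable (uniform_count_measure (pairs n))"
  for f :: "nat \<times> nat \<Rightarrow> 'a::topological_space"
  by (simp add: measurable_def sets_uniform_count_measure space_uniform_count_measure)

lemma indep_summands:
  "prob_space.indep_vars sample_space (\<lambda>_. borel) (\<lambda>n \<omega>. summand n (\<omega> n)) UNIV"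
  unfolding sample_space_def
  by (rule prob_space.indep_vars_compose2[where Y = summand, OF _ indep_vars_PiM_coordinates])
     (auto intro!: prob_space_PiM prob_space_pairs measurable_pairs)

lemma measurable_summand [measurable]: "(\<lambda>\<omega>. summand n (\<omega> n)) \<in> borel_measurable sample_space"
  unfolding sample_space_def
  by (rule measurable_compose[where f = "\<lambda>\<omega>. \<omega> n" and N = "uniform_count_measure (pairs n)"])
     (auto intro: measurable_pairs)

lemma measurable_series [measurable]: "series \<in> borel_measurable sample_space"
  unfolding series_def by measurable

lemma prob_space_law: "prob_space law"
  unfolding law_def by (intro prob_space.prob_space_distr prob_space_sample_space measurable_series)

lemma law_in_prob_on: "law \<in> prob_on Liouville_set"
proof -
  have "emeasure law (UNIV - Liouville_set) = emeasure sample_space (series -` (UNIV - Liouville_set) \<inter> space sample_space)"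
    unfolding law_def by (intro emeasure_distr measurable_series) (use Liouville_set_borel in auto)
  also have "series -` (UNIV - Liouville_set) \<inter> space sample_space = {}"
    using series_in_Liouville_set space_sample_space by auto
  finally show ?thesis using prob_space_law by (simp add: prob_on_def law_def)
qed

text \<open>The series is the n-th summand plus the sum of the others. These are independent, so the
  characteristic function factors, and the second factor has modulus at most 1.\<close>

lemma norm_char_law_le:
  "norm (char law t) \<le> norm (char (distr sample_space borel (\<lambda>\<omega>. summand n (\<omega> n))) t)"
proof -
  interpret prob_space sample_space by (rule prob_space_sample_space)
  let ?Y = "\<lambda>n \<omega>. summand n (\<omega> n)"
  let ?B = "UNIV - {n}"
  \<comment> \<open>Replacing the n-th term by 0 makes the remaining sum a measurable function of
    the coordinates in \<open>?B\<close> alone, to which independence of the two blocks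
    applies.\<close>
  let ?g = "\<lambda>f::nat \<Rightarrow> real. \<Sum>k. if k = n then 0 else f k"
  let ?Z = "\<lambda>\<omega>. \<Sum>k. if k = n then 0 else ?Y k \<omega>"
  have "indep_var (PiM {n} (\<lambda>_. borel)) (\<lambda>\<omega>. restrict (\<lambda>i. ?Y i \<omega>) {n})
                  (PiM ?B (\<lambda>_. borel)) (\<lambda>\<omega>. restrict (\<lambda>i. ?Y i \<omega>) ?B)"
    by (rule indep_var_restrict[OF indep_summands]) auto
  then have "indep_var borel ((\<lambda>f. f n) \<circ> (\<lambda>\<omega>. restrict (\<lambda>i. ?Y i \<omega>) {n}))
                  borel (?g \<circ> (\<lambda>\<omega>. restrict (\<lambda>i. ?Y i \<omega>) ?B))"
  proof (rule indep_var_compose)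
    have "(\<lambda>f. if k = n then 0 else f k) \<in> borel_measurable (PiM ?B (\<lambda>_. borel :: real measure))" for k
      by (cases "k = n") auto
    then show "?g \<in> borel_measurable (PiM ?B (\<lambda>_. borel))" by (rule borel_measurable_suminf)
  qed auto
  moreover have "(\<lambda>f. f n) \<circ> (\<lambda>\<omega>. restrict (\<lambda>i. ?Y i \<omega>) {n}) = ?Y n" by auto
  moreover have "?g \<circ> (\<lambda>\<omega>. restrict (\<lambda>i. ?Y i \<omega>) ?B) = ?Z"
    by (auto simp: fun_eq_iff intro!: suminf_cong)
  ultimately have indep: "indep_var borel (?Y n) borel ?Z" by simp
  have "law = distr sample_space borel (\<lambda>\<omega>. ?Y n \<omega> + ?Z \<omega>)"
    unfolding law_def
  proof (intro distr_cong refl)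
    fix \<omega> assume \<omega>: "\<omega> \<in> space sample_space"
    have sm: "summable (\<lambda>k. ?Y k \<omega>)"
      using summable_summands[of \<omega> 0] space_sample_space[OF \<omega>] by simp
    have "(\<lambda>k. if k = n then ?Y k \<omega> else 0) sums ?Y n \<omega>" by (rule sums_single)
    from sums_diff[OF summable_sums[OF sm] this]
    have "(\<lambda>k. ?Y k \<omega> - (if k = n then ?Y k \<omega> else 0)) sums (series \<omega> - ?Y n \<omega>)"
      by (simp add: series_def)
    moreover have "(\<lambda>k. ?Y k \<omega> - (if k = n then ?Y k \<omega> else 0)) = (\<lambda>k. if k = n then 0 else ?Y k \<omega>)"
      by auto
    ultimately have "(\<lambda>k. if k = n then 0 else ?Y k \<omega>) sums (series \<omega> - ?Y n \<omega>)" by simp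
    then show "series \<omega> = ?Y n \<omega> + ?Z \<omega>" by (simp add: sums_iff)
  qed
  then have "char law t = char (distr sample_space borel (?Y n)) t * char (distr sample_space borel ?Z) t"
    using char_distr_add[OF indep, of t] by simp
  moreover have "real_distribution (distr sample_space borel ?Z)"
    by (intro real_distribution_distr indep_var_rv2[OF indep])
  then have "norm (char (distr sample_space borel ?Z) t) \<le> 1"
    by (rule real_distribution.cmod_char_le_1)
  ultimately show ?thesis by (simp add: norm_mult mult_left_le)
qed

text \<open>This brings the characteristic function into the shape of
  \<open>window_exponential_sum_bound\<close> with \<eta> = t / (2 \<pi> P_n).\<close>

lemma char_summand:
  "char (distr sample_space borel (\<lambda>\<omega>. summand n (\<omega> n))) t =
     (\<Sum>q\<in>{M n..<M n + (b n)\<^sup>2}. \<Sum>p=1..M n. cis (real p * (2 * pi * ((t / (2 * pi * P n)) / real q))))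
       / of_nat ((b n)\<^sup>2 * M n)"
proof -
  interpret product_prob_space "\<lambda>n. uniform_count_measure (pairs n)" UNIV
    by (intro product_prob_spaceI prob_space_pairs)
  have "char (distr sample_space borel (\<lambda>\<omega>. summand n (\<omega> n))) t =
      (\<integral>\<omega>. iexp (t * summand n (\<omega> n)) \<partial>sample_space)"
    unfolding char_def by (subst integral_distr) auto
  also have "\<dots> = (\<integral>z. iexp (t * summand n z) \<partial>(distr sample_space (uniform_count_measure (pairs n)) (\<lambda>\<omega>. \<omega> n)))"
    unfolding sample_space_def by (subst integral_distr) (auto intro: measurable_pairs)
  also have "\<dots> = (\<integral>z. iexp (t * summand n z) \<partial>uniform_count_measure (pairs n))"
    unfolding sample_space_def by (simp add: PiM_component)
  also have "\<dots> = (\<Sum>z\<in>pairs n. iexp (t * summand n z)) / card (pairs n)"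
    unfolding uniform_count_measure_def
    by (subst lebesgue_integral_point_measure_finite)
       (auto simp: finite_pairs sum_divide_distrib scaleR_conv_of_real)
  also have "(\<Sum>z\<in>pairs n. iexp (t * summand n z)) =
      (\<Sum>(q, p)\<in>pairs n. cis (real p * (2 * pi * ((t / (2 * pi * P n)) / real q))))"
    by (intro sum.cong refl) (auto simp: summand_def cis_conv_exp field_simps)
  finally show ?thesis unfolding card_pairs by (simp add: pairs_def sum.cartesian_product)
qed

lemma fourier_law_bound:
  assumes "real (P n) \<le> \<bar>\<xi>\<bar>" "\<bar>\<xi>\<bar> \<le> P n * real (R n) ^ 2"
  shows "norm (fourier_meas law \<xi>) \<le> (2 + 6 * u n) * (\<bar>\<xi>\<bar> / P n) powr (-(1 / (4 * (u n)\<^sup>2)))"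
proof -
  define \<eta> where "\<eta> = - \<xi> / P n"
  have P: "real (P n) > 0" using P_pos by simp
  have 1: "1 \<le> \<bar>\<eta>\<bar>" using assms P by (simp add: \<eta>_def)
  have 2: "\<bar>\<eta>\<bar> \<le> real (b n) ^ (4 * (u n)\<^sup>2)"
  proof -
    have "\<bar>\<eta>\<bar> \<le> real (R n) ^ 2" using assms P by (simp add: \<eta>_def field_simps)
    then show ?thesis by (simp add: R_def ac_simps flip: power_mult)
  qed
  have eq: "(- 2 * pi * \<xi>) / (2 * pi * P n) = \<eta>" using P by (simp add: \<eta>_def field_simps)
  let ?S = "\<Sum>q\<in>{M n..<M n + (b n)\<^sup>2}. \<Sum>p=1..M n. cis (real p * (2 * pi * (\<eta> / real q)))"
  have "norm (fourier_meas law \<xi>) \<le> norm (?S / of_nat ((b n)\<^sup>2 * M n))"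
    unfolding fourier_meas_eq_char using norm_char_law_le[of "- 2 * pi * \<xi>" n]
    unfolding char_summand eq .
  also have "\<dots> = norm ?S / ((b n)\<^sup>2 * M n)" by (simp only: norm_divide norm_of_nat)
  also have "\<dots> \<le> (2 + 6 * u n) * \<bar>\<eta>\<bar> powr (-(1 / (4 * (u n)\<^sup>2)))"
  proof -
    have "norm ?S \<le> real ((b n)\<^sup>2 * M n) * ((2 + 6 * u n) * \<bar>\<eta>\<bar> powr (-(1 / (4 * (u n)\<^sup>2))))"
      unfolding M_def by (rule window_exponential_sum_bound[OF b_ge_2 u_pos 1 2])
    moreover have "real ((b n)\<^sup>2 * M n) > 0" using M_pos[of n] b_ge_2[of n] by simp
    ultimately show ?thesis by (simp only: pos_divide_le_eq mult.commute)
  qed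
  also have "\<bar>\<eta>\<bar> = \<bar>\<xi>\<bar> / P n" by (simp add: \<eta>_def)
  finally show ?thesis .
qed

text \<open>
  At frequency \<open>\<xi>\<close> the stage \<open>n + 1\<close> with \<open>P (n+1) R n \<le> \<xi> < P (n+2) R (n+1)\<close> is the one that
  gives decay; there \<open>\<xi> \<le> (\<xi> / P (n+1))\<^sup>3\<close>.
\<close>
lemma fourier_law_block_bound:
  assumes "real (P (Suc n) * R n) \<le> \<bar>\<xi>\<bar>" "\<bar>\<xi>\<bar> \<le> real (P (Suc (Suc n)) * R (Suc n))"
  shows "norm (fourier_meas law \<xi>)
     \<le> (2 + 6 * u (Suc n)) * \<bar>\<xi>\<bar> powr (-(1 / (12 * (u (Suc n))\<^sup>2)))"
proof -
  define \<eta> where "\<eta> = \<bar>\<xi>\<bar> / P (Suc n)"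
  define \<delta> where "\<delta> = 1 / (4 * (real (u (Suc n)))\<^sup>2)"
  have d: "\<delta> \<ge> 0" by (simp add: \<delta>_def)
  have P: "real (P (Suc n)) > 0" using P_pos by simp
  have R: "real (R n) \<ge> 1" using R_ge_2[of n] by simp
  have RPeta: "real (R n) \<le> \<eta>" using assms(1) P by (simp add: \<eta>_def field_simps)
  \<comment> \<open>Here the growth of \<open>b\<close> enters: \<open>P n\<close> is at most
    \<open>b n\<close>, hence at most \<open>R n\<close>, so P_(n+1) \<le> R_n^2 \<le>
    \<eta>^2.\<close>
  have "real (P (Suc n)) = real (P n) * real (R n)" by (simp add: P_Suc)
  also have "\<dots> \<le> real (R n) * real (R n)"
    using P_le_b[of n] b_le_R[of n] by (intro mult_right_mono) auto
  also have "\<dots> \<le> \<eta> * \<eta>" using RPeta by (intro mult_mono) auto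
  finally have Pe: "real (P (Suc n)) \<le> \<eta> * \<eta>" .
  have "\<bar>\<xi>\<bar> = real (P (Suc n)) * \<eta>" using P by (simp add: \<eta>_def)
  also have "\<dots> \<le> (\<eta> * \<eta>) * \<eta>" using Pe R RPeta by (intro mult_right_mono) auto
  finally have xi: "\<bar>\<xi>\<bar> \<le> \<eta> ^ 3" by (simp add: power3_eq_cube)
  have xi0: "\<bar>\<xi>\<bar> > 0" and eta0: "\<eta> > 0" using RPeta R P by (auto simp: \<eta>_def)
  \<comment> \<open>Expressing the decay in \<xi> instead of \<eta> costs a factor 3 in the
    exponent, which turns 4 into 12.\<close>
  have "\<eta> powr (-\<delta>) = (\<eta> ^ 3) powr (-(\<delta>/3))"
  proof -
    have "\<eta> ^ 3 = \<eta> powr 3" using eta0 by simp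
    then show ?thesis by (simp only: powr_powr) simp
  qed
  also have "\<dots> \<le> \<bar>\<xi>\<bar> powr (-(\<delta>/3))" using xi xi0 d by (intro powr_mono2') auto
  finally have le: "\<eta> powr (-\<delta>) \<le> \<bar>\<xi>\<bar> powr (-(\<delta>/3))" .
  have "real (P (Suc n)) * 1 \<le> real (P (Suc n)) * real (R n)" using R by (intro mult_left_mono) auto
  then have "real (P (Suc n)) \<le> \<bar>\<xi>\<bar>" using assms(1) by simp
  moreover have "\<bar>\<xi>\<bar> \<le> real (P (Suc n)) * (real (R (Suc n)))\<^sup>2"
    using assms(2) P_Suc[of "Suc n"] by (simp add: power2_eq_square)
  ultimately have "norm (fourier_meas law \<xi>) \<le> (2 + 6 * u (Suc n)) * \<eta> powr (-\<delta>)"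
    using fourier_law_bound[of "Suc n" \<xi>] by (simp add: \<eta>_def \<delta>_def)
  also have "\<dots> \<le> (2 + 6 * u (Suc n)) * \<bar>\<xi>\<bar> powr (-(\<delta>/3))"
    using le by (intro mult_left_mono) auto
  finally show ?thesis by (simp add: \<delta>_def)
qed

text \<open>The block ends are unbounded, so there is a first one beyond \<open>x\<close>.
  Minimality gives the lower bound, and the hypothesis supplies it for the first block.\<close>

lemma exists_block:
  assumes "real (P 1 * R 0) \<le> x"
  shows "\<exists>n. real (P (Suc n) * R n) \<le> x \<and> x \<le> real (P (Suc (Suc n)) * R (Suc n))"
proof -
  define T where "T = (\<lambda>n. real (P (Suc n) * R n))"
  obtain N :: nat where N: "x < 2 ^ N" using real_arch_pow[of 2 x] by auto
  have "2 ^ N \<le> T (Suc N)"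
  proof -
    have "(2::nat) ^ N \<le> P 0 * 2 ^ (N + 2) * 1" using P_pos[of 0] by (simp add: P_def)
    also have "\<dots> \<le> P (0 + (N + 2)) * R (Suc N)"
      using P_growth[of 0 "N + 2"] R_ge_2[of "Suc N"] by (intro mult_mono) auto
    finally have "real (2 ^ N) \<le> T (Suc N)" unfolding T_def by (simp only: of_nat_le_iff) simp
    then show ?thesis by simp
  qed
  then have ex: "x \<le> T (Suc N)" using N by simp
  define m where "m = (LEAST m. x \<le> T (Suc m))"
  have m: "x \<le> T (Suc m)" unfolding m_def using ex by (rule LeastI)
  moreover have "T m \<le> x"
  proof (cases m)
    case 0
    then show ?thesis using assms by (simp add: T_def)
  next
    case (Suc k)
    then have "\<not> x \<le> T (Suc k)" using not_less_Least[of k "\<lambda>m. x \<le> T (Suc m)"] by (simp add: m_def)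
    then show ?thesis using Suc by simp
  qed
  ultimately show ?thesis by (auto simp: T_def)
qed

end

section \<open>Choice of the parameters for a given slowly decaying function\<close>

lemma exists_recursively_growing_sequence:
  fixes g :: "nat \<Rightarrow> nat \<Rightarrow> nat" and Z :: "nat \<Rightarrow> nat"
  shows "\<exists>b. \<forall>n. 2 * (\<Prod>k<n. g k (b k)) + Z n \<le> b n"
proof -
  \<comment> \<open>The recursion runs over the products instead of the sequence: \<open>W n\<close>
    determines \<open>b n\<close>, which in turn supplies the next factor.\<close>
  define W where "W = rec_nat 1 (\<lambda>n w. w * g n (2 * w + Z n))"
  define b where "b = (\<lambda>n. 2 * W n + Z n)"
  have "W n = (\<Prod>k<n. g k (b k))" for n
    by (induction n) (simp_all add: W_def b_def)
  then show ?thesis by (metis b_def order_refl)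
qed

text \<open>The block bound of each stage is eventually below \<open>f\<close>, say beyond
  \<open>Z n\<close>. Requiring \<open>b n\<close> to be at least \<open>Z n\<close> makes the block
  start beyond this threshold.\<close>

lemma slow_decay_imp_decay_class:
  fixes f :: "real \<Rightarrow> real"
  assumes slow: "\<And>\<epsilon>. \<epsilon> > 0 \<Longrightarrow> \<forall>\<^sub>F \<xi> in at_top. \<xi> powr (-\<epsilon>) < f \<xi>"
  shows "f \<in> decay_class Liouville_set"
proof -
  define u :: "nat \<Rightarrow> nat" where "u = (\<lambda>n. 3 * Suc n)"
  have "\<exists>Z::nat. \<forall>x\<ge>real Z. (2 + 6 * u (Suc n)) * x powr (-(1 / (12 * (u (Suc n))\<^sup>2))) \<le> f x" for n
  proof -
    \<comment> \<open>Half of the exponent of the block bound: one factor x^(-\<epsilon>) absorbs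
      the constant 2 + 6u, the other stays below \<open>f\<close>.\<close>
    define \<epsilon> where "\<epsilon> = 1 / (24 * real ((u (Suc n))\<^sup>2))"
    have e: "\<epsilon> > 0" by (simp add: \<epsilon>_def u_def)
    have "((\<lambda>x::real. x powr (-\<epsilon>)) \<longlongrightarrow> 0) at_top"
      using e by (intro tendsto_neg_powr filterlim_ident) auto
    then have "\<forall>\<^sub>F x::real in at_top. x powr (-\<epsilon>) < 1 / (2 + 6 * u (Suc n))"
      by (rule order_tendstoD) simp
    with slow[OF e]
    have "\<forall>\<^sub>F x in at_top. (2 + 6 * u (Suc n)) * x powr (-(1 / (12 * (u (Suc n))\<^sup>2))) \<le> f x"
    proof eventually_elim
      case (elim x)
      have "1 / (12 * real ((u (Suc n))\<^sup>2)) = \<epsilon> + \<epsilon>" by (simp add: \<epsilon>_def)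
      then have "x powr (-(1 / (12 * (u (Suc n))\<^sup>2))) = x powr (-\<epsilon>) * x powr (-\<epsilon>)"
        by (simp flip: powr_add)
      then have "(2 + 6 * u (Suc n)) * x powr (-(1 / (12 * (u (Suc n))\<^sup>2)))
          = ((2 + 6 * u (Suc n)) * x powr (-\<epsilon>)) * x powr (-\<epsilon>)" by simp
      also have "\<dots> \<le> 1 * x powr (-\<epsilon>)"
        using elim(2) by (intro mult_right_mono) (auto simp: field_simps)
      finally show ?case using elim(1) by simp
    qed
    then obtain N where N: "\<And>x. x \<ge> N \<Longrightarrow> (2 + 6 * u (Suc n)) * x powr (-(1 / (12 * (u (Suc n))\<^sup>2))) \<le> f x"
      unfolding eventually_at_top_linorder by auto
    obtain Z :: nat where "N \<le> real Z" using real_arch_simple by blast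
    then show ?thesis using N by (intro exI[of _ Z]) auto
  qed
  then obtain Z :: "nat \<Rightarrow> nat" where Z: "\<And>n x. x \<ge> real (Z n) \<Longrightarrow>
      (2 + 6 * u (Suc n)) * x powr (-(1 / (12 * (u (Suc n))\<^sup>2))) \<le> f x"
    using choice[of "\<lambda>n Z. \<forall>x\<ge>real Z. (2 + 6 * u (Suc n)) * x powr (-(1 / (12 * (u (Suc n))\<^sup>2))) \<le> f x"]
    by blast
  \<comment> \<open>The summand \<open>Z n\<close> places the blocks beyond the thresholds, and the
    2 ensures that every base is at least 2.\<close>
  obtain b :: "nat \<Rightarrow> nat" where b:
    "\<And>n. 2 * (\<Prod>k<n. 2 * b k ^ (4 * u k) * b k ^ (2 * (u k)\<^sup>2)) + (Z n + 2) \<le> b n"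
    using exists_recursively_growing_sequence[of "\<lambda>k c. 2 * c ^ (4 * u k) * c ^ (2 * (u k)\<^sup>2)" "\<lambda>n. Z n + 2"]
    by blast
  define M where "M = (\<lambda>n. b n ^ (4 * u n))"
  define R where "R = (\<lambda>n. b n ^ (2 * (u n)\<^sup>2))"
  define P where "P = (\<lambda>n. \<Prod>k<n. R k)"
  have b_ge: "2 \<le> b n" "Z n \<le> b n" "2 * (\<Prod>k<n. 2 * M k * R k) \<le> b n" for n
    using b[of n] unfolding M_def R_def by linarith+
  interpret liouville_series b u M R P
  proof unfold_locales
    show "2 \<le> b n" for n by (rule b_ge(1))
    show "2 * (\<Prod>k<n. 2 * b k ^ (4 * (3 * Suc k)) * b k ^ (2 * (3 * Suc k)\<^sup>2)) \<le> b n" for n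
      using b_ge(3)[of n] unfolding M_def R_def u_def .
  qed (simp_all only: u_def M_def R_def P_def)
  have "norm (fourier_meas law \<xi>) \<le> 1 * f \<bar>\<xi>\<bar>" if large: "real (P 1 * R 0) \<le> \<bar>\<xi>\<bar>" for \<xi>
  proof -
    obtain n where n: "real (P (Suc n) * R n) \<le> \<bar>\<xi>\<bar>" "\<bar>\<xi>\<bar> \<le> real (P (Suc (Suc n)) * R (Suc n))"
      using exists_block[OF large] by blast
    have "Z n \<le> R n" using b_ge(2)[of n] b_le_R[of n] by simp
    also have "\<dots> \<le> P (Suc n) * R n" using mult_le_mono1[of 1 "P (Suc n)" "R n"] P_pos[of "Suc n"] by simp
    finally have "real (Z n) \<le> \<bar>\<xi>\<bar>" using n(1) by linarith
    from Z[OF this] fourier_law_block_bound[OF n] show ?thesis by simp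
  qed
  moreover have "0 < real (P 1 * R 0)" using P_pos[of 1] R_ge_2[of 0] by simp
  ultimately show ?thesis
    unfolding decay_class_def
    by (intro CollectI bexI[OF _ law_in_prob_on] exI[of _ 1] exI[of _ "real (P 1 * R 0)"]) auto
qed

section \<open>Power decay excludes the Liouville numbers\<close>

lemma integrable_one_plus_abs_powr:
  fixes \<beta> :: real
  assumes "\<beta> > 0"
  shows "integrable lborel (\<lambda>t. (1 + \<bar>t\<bar>) powr (-\<beta> - 1))"
proof -
  define v where "v = (\<lambda>t::real. (1 + t) powr (-\<beta> - 1) * indicator {0..} t)"
  have v_meas [measurable]: "v \<in> borel_measurable borel" unfolding v_def by measurable
  have v: "integrable lborel v"
  proof (rule integrableI_nn_integral_finite)
    have "(\<integral>\<^sup>+t. ennreal ((1 + t) powr (-\<beta> - 1)) * indicator {0..} t \<partial>lborel)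
        = ennreal (0 - (- ((1 + 0) powr (-\<beta>) / \<beta>)))"
    proof (rule nn_integral_FTC_atLeast)
      show "((\<lambda>x::real. - ((1 + x) powr (-\<beta>) / \<beta>)) \<longlongrightarrow> 0) at_top"
      proof -
        have "((\<lambda>x::real. (1 + x) powr (-\<beta>)) \<longlongrightarrow> 0) at_top"
          using assms by (intro tendsto_neg_powr filterlim_tendsto_add_at_top[OF tendsto_const] filterlim_ident) auto
        from tendsto_minus[OF tendsto_divide[OF this tendsto_const[of \<beta>]]] show ?thesis using assms by simp
      qed
      fix x :: real assume "0 \<le> x"
      then show "((\<lambda>x. - ((1 + x) powr (-\<beta>) / \<beta>)) has_real_derivative (1 + x) powr (-\<beta> - 1)) (at x)"
        using assms by (auto intro!: derivative_eq_intros simp: algebra_simps)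
    qed auto
    moreover have "ennreal (v t) = ennreal ((1 + t) powr (-\<beta> - 1)) * indicator {0..} t" for t
      by (auto simp: v_def indicator_def)
    ultimately show "(\<integral>\<^sup>+t. v t \<partial>lborel) = ennreal (0 - (- ((1 + 0) powr (-\<beta>) / \<beta>)))" by simp
  qed (auto simp: v_def)
  have "integrable lborel (\<lambda>t. v (-t))"
    using lborel_integrable_real_affine[OF v, of "-1" 0] by simp
  \<comment> \<open>The two halves both count t = 0, so their sum dominates the integrand instead of
    being equal to it.\<close>
  then have "integrable lborel (\<lambda>t. v t + v (-t))" using v by (intro Bochner_Integration.integrable_add)
  then show ?thesis
    by (rule Bochner_Integration.integrable_bound) (auto simp: v_def indicator_def)
qed

text \<open>With h = b - a and s = 1 + |t|, the kernel is bounded by h and by 2/|t|. Interpolation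
  between the two gives h^\<beta> s^(\<beta>-1): after multiplication by s, the first bound serves
  for h s \<le> 1, and a bound by 4 serves for h s > 1.\<close>

lemma norm_inversion_kernel_le:
  fixes a b t \<beta> :: real
  assumes ab: "a < b" "b - a \<le> 1" and \<beta>: "0 < \<beta>" "\<beta> \<le> 1"
  shows "norm ((iexp (-(t * a)) - iexp (-(t * b))) / (\<i> * t)) \<le> 4 * (b - a) powr \<beta> * (1 + \<bar>t\<bar>) powr (\<beta> - 1)"
\<comment> \<open>At t = 0 the quotient is 0 by the convention for division by zero.\<close>
proof (cases "t = 0")
  case False
  define h where "h = b - a"
  define s where "s = 1 + \<bar>t\<bar>"
  define F where "F = norm ((iexp (-(t * a)) - iexp (-(t * b))) / (\<i> * t))"
  have h: "0 < h" "h \<le> 1" and s: "s \<ge> 1" using ab by (auto simp: h_def s_def)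
  have F1: "F \<le> h"
    using Levy_Inversion_aux2[of a b "-t"] ab False
    by (simp add: F_def h_def norm_divide norm_mult norm_minus_commute)
  have F2: "F \<le> 2 / \<bar>t\<bar>"
  proof -
    have "norm (iexp (-(t * a)) - iexp (-(t * b))) \<le> 2"
      using norm_triangle_ineq4[of "iexp (-(t * a))" "iexp (-(t * b))"]
      by (simp flip: of_real_mult of_real_minus)
    then show ?thesis by (simp add: F_def norm_divide norm_mult divide_right_mono)
  qed
  have F0: "F \<ge> 0" by (simp add: F_def)
  have "F * s \<le> 4 * (h * s) powr \<beta>"
  proof (cases "h * s \<le> 1")
    case True
    have "F * s \<le> h * s" using F1 s by (intro mult_right_mono) auto
    also have "\<dots> = (h * s) powr 1" using h s by simp
    also have "\<dots> \<le> (h * s) powr \<beta>" using True h s \<beta> by (intro powr_mono') auto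
    finally show ?thesis using powr_ge_zero[of "h * s" \<beta>] by linarith
  next
    case False
    have "F * s \<le> 4"
    proof (cases "\<bar>t\<bar> \<ge> 1")
      case True
      have "F * s \<le> 2 / \<bar>t\<bar> * (2 * \<bar>t\<bar>)" using F2 F0 s True by (intro mult_mono) (auto simp: s_def)
      then show ?thesis using True by simp
    next
      case False
      have "F * s \<le> 1 * 2" using F1 F0 h False by (intro mult_mono) (auto simp: s_def)
      then show ?thesis by simp
    qed
    moreover have "1 \<le> (h * s) powr \<beta>" using False \<beta> by (intro ge_one_powr_ge_zero) auto
    ultimately show ?thesis by linarith
  qed
  also have "\<dots> = 4 * h powr \<beta> * s powr (\<beta> - 1) * s"
    using h s by (simp add: powr_mult powr_diff)
  finally have "F \<le> 4 * h powr \<beta> * s powr (\<beta> - 1)"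
    using s by (intro mult_right_le_imp_le[of F s]) auto
  then show ?thesis by (simp only: F_def h_def s_def)
qed simp

text \<open>Levy's inversion formula, which requires endpoints that are not atoms. With \<beta> =
  \<alpha>/2 half of the decay pays for the power of the interval length, and the other half leaves
  the integrable majorant (1 + |t|)^(-\<beta>-1).\<close>

lemma (in real_distribution) measure_Ioc_le_of_char_decay:
  assumes \<alpha>: "0 < \<alpha>" "\<alpha> \<le> 1" and C: "\<And>t. norm (char M t) \<le> C * (1 + \<bar>t\<bar>) powr (-\<alpha>)"
  shows "\<exists>K\<ge>0. \<forall>a b. a < b \<longrightarrow> b - a \<le> 1 \<longrightarrow> measure M {a} = 0 \<longrightarrow> measure M {b} = 0 \<longrightarrow>
           measure M {a<..b} \<le> K * (b - a) powr (\<alpha>/2)"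
proof -
  define \<beta> where "\<beta> = \<alpha> / 2"
  have \<beta>: "0 < \<beta>" "\<beta> \<le> 1" using \<alpha> by (auto simp: \<beta>_def)
  define w where "w = (\<lambda>t::real. (1 + \<bar>t\<bar>) powr (-\<beta> - 1))"
  have w: "integrable lborel w" unfolding w_def by (rule integrable_one_plus_abs_powr[OF \<beta>(1)])
  have C0: "C \<ge> 0" using order_trans[OF norm_ge_zero C[of 0]] by simp
  define K where "K = 4 * C * integral\<^sup>L lborel w"
  have "K \<ge> 0" unfolding K_def using C0 by (intro mult_nonneg_nonneg integral_nonneg) (auto simp: w_def)
  moreover have "measure M {a<..b} \<le> K * (b - a) powr (\<alpha>/2)"
    if ab: "a < b" "b - a \<le> 1" and atoms: "measure M {a} = 0" "measure M {b} = 0" for a b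
  proof -
    define g where "g = (\<lambda>t::real. (iexp (-(t * a)) - iexp (-(t * b))) / (\<i> * t) * char M t)"
    have g_meas [measurable]: "g \<in> borel_measurable borel" unfolding g_def by measurable
    define k where "k = 4 * C * (b - a) powr \<beta>"
    have g_le: "norm (g t) \<le> k * w t" for t
    proof -
      have "norm (g t) \<le> (4 * (b - a) powr \<beta> * (1 + \<bar>t\<bar>) powr (\<beta> - 1)) * (C * (1 + \<bar>t\<bar>) powr (-\<alpha>))"
        unfolding g_def norm_mult
        by (intro mult_mono C norm_inversion_kernel_le ab \<beta>) auto
      also have "\<dots> = k * ((1 + \<bar>t\<bar>) powr (\<beta> - 1) * (1 + \<bar>t\<bar>) powr (-\<alpha>))" by (simp add: k_def)
      also have "(1 + \<bar>t\<bar>) powr (\<beta> - 1) * (1 + \<bar>t\<bar>) powr (-\<alpha>) = w t"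
        by (simp add: w_def \<beta>_def flip: powr_add)
      finally show ?thesis .
    qed
    have kw: "integrable lborel (\<lambda>t. k * w t)" using w by simp
    have "norm (CLBINT t=-real T..real T. g t) \<le> k * integral\<^sup>L lborel w" for T :: nat
    proof -
      have dom: "norm (indicator (einterval (-ereal (real T)) (ereal (real T))) t *\<^sub>R g t) \<le> k * w t" for t
        using g_le[of t] norm_ge_zero[of "g t"] by (auto simp: indicator_def simp del: norm_ge_zero)
      have "integrable lborel (\<lambda>t. indicator (einterval (-ereal (real T)) (ereal (real T))) t *\<^sub>R g t)"
        by (rule Bochner_Integration.integrable_bound[OF kw])
           (use dom in \<open>auto intro: order_trans[OF _ abs_ge_self]\<close>)
      then have "norm (\<integral>t. indicator (einterval (-ereal (real T)) (ereal (real T))) t *\<^sub>R g t \<partial>lborel)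
          \<le> (\<integral>t. k * w t \<partial>lborel)"
        using kw dom by (intro Bochner_Integration.integral_norm_bound_integral) auto
      then show ?thesis by (simp add: interval_lebesgue_integral_le_eq set_lebesgue_integral_def)
    qed
    then have le: "norm (1 / (2 * pi) * (CLBINT t=-real T..real T. g t)) \<le> k * integral\<^sup>L lborel w" for T :: nat
    proof -
      have "norm (1 / (2 * pi) * (CLBINT t=-real T..real T. g t)) = 1 / (2 * pi) * norm (CLBINT t=-real T..real T. g t)"
        by (simp add: norm_mult norm_divide)
      also have "\<dots> \<le> 1 * norm (CLBINT t=-real T..real T. g t)"
        using pi_gt3 by (intro mult_right_mono) auto
      finally show ?thesis using \<open>norm (CLBINT t=-real T..real T. g t) \<le> k * integral\<^sup>L lborel w\<close> by simp
    qed
    have lim: "(\<lambda>T::nat. 1 / (2 * pi) * (CLBINT t=-real T..real T. g t)) \<longlonglongrightarrow> complex_of_real (measure M {a<..b})"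
      unfolding g_def using Levy_Inversion[of a b] ab atoms by simp
    have "norm (complex_of_real (measure M {a<..b})) \<le> k * integral\<^sup>L lborel w"
      using tendsto_norm[OF lim] le by (intro LIMSEQ_le_const2) auto
    then show ?thesis by (simp add: k_def K_def \<beta>_def mult_ac)
  qed
  ultimately show ?thesis by blast
qed

text \<open>There are only countably many atoms, so the interval can be enlarged to one with
  atomless endpoints and length at most 4r. The restriction r \<le> 1/4 keeps this length at most
  1.\<close>

lemma (in real_distribution) measure_Icc_le_of_char_decay:
  assumes \<alpha>: "0 < \<alpha>" "\<alpha> \<le> 1" and C: "\<And>t. norm (char M t) \<le> C * (1 + \<bar>t\<bar>) powr (-\<alpha>)"
  shows "\<exists>K\<ge>0. \<forall>x r. 0 < r \<longrightarrow> r \<le> 1/4 \<longrightarrow> measure M {x - r..x + r} \<le> K * r powr (\<alpha>/2)"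
proof -
  obtain K where K0: "K \<ge> 0" and K: "\<And>a b. a < b \<Longrightarrow> b - a \<le> 1 \<Longrightarrow> measure M {a} = 0 \<Longrightarrow>
      measure M {b} = 0 \<Longrightarrow> measure M {a<..b} \<le> K * (b - a) powr (\<alpha>/2)"
    using measure_Ioc_le_of_char_decay[OF assms] by blast
  have "measure M {x - r..x + r} \<le> (K * 4 powr (\<alpha>/2)) * r powr (\<alpha>/2)" if r: "0 < r" "r \<le> 1/4" for x r
  proof -
    have non_atom: "\<exists>y\<in>{c<..<d}. measure M {y} = 0" if "c < d" for c d
      using open_minus_countable[OF countable_support, of "{c<..<d}"] that by auto
    obtain a where a: "x - 2 * r < a" "a < x - r" "measure M {a} = 0"
      using non_atom[of "x - 2 * r" "x - r"] r by auto
    obtain b where b: "x + r < b" "b < x + 2 * r" "measure M {b} = 0"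
      using non_atom[of "x + r" "x + 2 * r"] r by auto
    have "measure M {x - r..x + r} \<le> measure M {a<..b}"
      using a b by (intro finite_measure_mono) auto
    also have "\<dots> \<le> K * (b - a) powr (\<alpha>/2)" using a b r by (intro K) auto
    also have "\<dots> \<le> K * (4 * r) powr (\<alpha>/2)"
      using a b r \<alpha> K0 by (intro mult_left_mono powr_mono2) auto
    finally show ?thesis using r by (simp add: powr_mult)
  qed
  then show ?thesis using K0 by (intro exI[of _ "K * 4 powr (\<alpha>/2)"]) auto
qed


text \<open>There are at most 3 (N + 1) q intervals, each of mass at most K q^(-n\<beta>) \<le> K
  q^(-3-j). Of these powers one pays for the number of intervals, two remain for summing over q, and
  q^(-j) \<le> 2^(-j) becomes the small factor.\<close>

lemma (in real_distribution) measure_near_fractions_le: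
  fixes N n j q :: nat and K \<beta> :: real
  assumes K: "K \<ge> 0" "\<And>x r. 0 < r \<Longrightarrow> r \<le> 1/4 \<Longrightarrow> measure M {x - r..x + r} \<le> K * r powr \<beta>"
    and n: "n \<ge> 2" "3 + j \<le> real n * \<beta>" and q: "q \<ge> 2"
  shows "measure M (\<Union>m\<in>{- int ((N + 1) * q)..int ((N + 1) * q)}. {of_int m / q - 1 / real q ^ n..of_int m / q + 1 / real q ^ n})
      \<le> 3 * (N + 1) * K * (1/2) ^ j * (1 / real q ^ 2)"
proof -
  let ?r = "1 / real q ^ n"
  let ?I = "{- int ((N + 1) * q)..int ((N + 1) * q)}"
  have r: "0 < ?r" "?r \<le> 1/4"
  proof -
    have "(4::real) = 2 ^ 2" by simp
    also have "\<dots> \<le> real q ^ 2" using q by (intro power_mono) auto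
    also have "\<dots> \<le> real q ^ n" using q n by (intro power_increasing) auto
    finally show "?r \<le> 1/4" by (intro divide_left_mono) (use q in auto)
  qed (use q in simp)
  have "?r powr \<beta> = real q powr (-(real n * \<beta>))"
    using q by (simp add: powr_divide powr_minus_divide powr_powr flip: powr_realpow)
  also have "\<dots> \<le> real q powr (-(real (3 + j)))" using q n by (intro powr_mono) auto
  also have "\<dots> = 1 / real q ^ (3 + j)" using q by (simp add: powr_minus_divide powr_realpow del: of_nat_add)
  also have "\<dots> = 1 / real q ^ 3 * (1 / real q ^ j)" by (simp add: power_add)
  also have "\<dots> \<le> 1 / real q ^ 3 * (1 / 2 ^ j)"
    using q by (intro mult_left_mono divide_left_mono power_mono) auto
  finally have rb: "?r powr \<beta> \<le> 1 / real q ^ 3 * (1/2) ^ j" by (simp add: power_divide)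
  have "measure M (\<Union>m\<in>?I. {of_int m / q - ?r..of_int m / q + ?r})
      \<le> (\<Sum>m\<in>?I. measure M {of_int m / q - ?r..of_int m / q + ?r})"
    by (rule measure_UNION_le) auto
  also have "\<dots> \<le> of_nat (card ?I) * (K * (1 / real q ^ 3 * (1/2) ^ j))"
  proof (rule sum_bounded_above)
    fix m :: int
    show "measure M {of_int m / q - ?r..of_int m / q + ?r} \<le> K * (1 / real q ^ 3 * (1/2) ^ j)"
      using K(2)[OF r, of "of_int m / q"] mult_left_mono[OF rb K(1)] by (rule order_trans)
  qed
  also have "\<dots> \<le> real (3 * (N + 1) * q) * (K * (1 / real q ^ 3 * (1/2) ^ j))"
  proof (rule mult_right_mono)
    have "card {- int d..int d} = 2 * d + 1" for d by simp
    then have "card ?I = 2 * ((N + 1) * q) + 1" .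
    also have "\<dots> \<le> 3 * (N + 1) * q" using q by (simp add: algebra_simps)
    finally show "real (card ?I) \<le> real (3 * (N + 1) * q)" by (simp only: of_nat_le_iff)
  qed (use K(1) in auto)
  also have "\<dots> = 3 * (N + 1) * K * (1/2) ^ j * (1 / real q ^ 2)"
    using q by (simp add: field_simps power2_eq_square power3_eq_cube)
  finally show ?thesis .
qed

text \<open>For every j an n with n\<beta> \<ge> 3 + j yields a covering whose mass, summed over all
  denominators, is a constant times 2^(-j). Then j tends to infinity.\<close>

lemma (in real_distribution) Liouville_set_null:
  assumes K: "K \<ge> 0" "\<And>x r. 0 < r \<Longrightarrow> r \<le> 1/4 \<Longrightarrow> measure M {x - r..x + r} \<le> K * r powr \<beta>"
    and \<beta>: "\<beta> > 0"
  shows "measure M (Liouville_set \<inter> {- real N..real N}) = 0"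
proof -
  let ?L = "Liouville_set \<inter> {- real N..real N}"
  define s where "s = (\<Sum>i::nat. 1 / real (i + 2) ^ 2)"
  have sm: "summable (\<lambda>i::nat. 1 / real (i + 2) ^ 2)"
    using summable_ignore_initial_segment[OF inverse_power_summable[of 2, where 'a = real], of 2]
    by (simp add: inverse_eq_divide)
  have "measure M ?L \<le> (3 * (N + 1) * K * s) * (1/2) ^ j" for j :: nat
  proof -
    obtain k :: nat where k: "(3 + j) / \<beta> \<le> real k" using real_arch_simple by blast
    define n where "n = k + 2"
    have "(3 + j) / \<beta> * \<beta> \<le> real n * \<beta>" using k \<beta> by (intro mult_right_mono) (auto simp: n_def)
    then have n: "n \<ge> 2" "3 + j \<le> real n * \<beta>" using \<beta> by (auto simp: n_def)
    define A where "A = (\<lambda>i::nat. \<Union>m\<in>{- int ((N + 1) * (i + 2))..int ((N + 1) * (i + 2))}.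
      {of_int m / real (i + 2) - 1 / real (i + 2) ^ n..of_int m / real (i + 2) + 1 / real (i + 2) ^ n})"
    have A: "measure M (A i) \<le> 3 * (N + 1) * K * (1/2) ^ j * (1 / real (i + 2) ^ 2)" for i
      unfolding A_def by (rule measure_near_fractions_le[OF K n]) auto
    have A_sets: "range A \<subseteq> sets M" unfolding A_def by auto
    have A_summable: "summable (\<lambda>i. measure M (A i))"
      by (rule summable_comparison_test'[OF summable_mult[OF sm, of "3 * (N + 1) * K * (1/2) ^ j"], of 0])
         (use A in auto)
    have "?L \<subseteq> (\<Union>i. A i)"
    proof
      fix x assume x: "x \<in> ?L"
      \<comment> \<open>The Liouville condition is used with exponent n - 1, since division by
        \<open>q\<close> contributes the remaining power.\<close>
      then obtain q :: nat and m :: int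
        where q: "q \<ge> 2" and m: "\<bar>real q * x - of_int m\<bar> < inverse (real q ^ (n - 1))"
        unfolding Liouville_set_def dist_int_less_iff by blast
      have qn: "real q ^ n = real q * real q ^ (n - 1)" using n by (cases n) auto
      have "x - of_int m / q = (real q * x - of_int m) / q" using q by (simp add: field_simps)
      then have "\<bar>x - of_int m / q\<bar> = \<bar>real q * x - of_int m\<bar> / q" by simp
      also have "\<dots> \<le> inverse (real q ^ (n - 1)) / q" using m by (intro divide_right_mono) auto
      also have "\<dots> = 1 / real q ^ n" using q unfolding qn by (simp add: field_simps)
      finally have near: "\<bar>x - of_int m / q\<bar> \<le> 1 / real q ^ n" .
      have "inverse (real q ^ (n - 1)) \<le> 1" using q by (intro inverse_le_1_iff[THEN iffD2]) auto
      then have "\<bar>of_int m\<bar> \<le> \<bar>real q * x\<bar> + 1" using m by linarith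
      also have "\<bar>real q * x\<bar> \<le> real q * real N" using x by (auto simp: abs_mult intro!: mult_left_mono)
      also have "real q * real N + 1 \<le> real ((N + 1) * q)" using q by (simp add: algebra_simps)
      finally have "\<bar>m\<bar> \<le> int ((N + 1) * q)" by linarith
      then have "m \<in> {- int ((N + 1) * q)..int ((N + 1) * q)}" unfolding atLeastAtMost_iff by linarith
      moreover have "x \<in> {of_int m / q - 1 / real q ^ n..of_int m / q + 1 / real q ^ n}"
        using near unfolding atLeastAtMost_iff by linarith
      moreover obtain i where "q = i + 2" using q by (metis add.commute le_Suc_ex)
      ultimately have "x \<in> A i" unfolding A_def by blast
      then show "x \<in> (\<Union>i. A i)" by blast
    qed
    then have "measure M ?L \<le> measure M (\<Union>i. A i)"
      using A_sets by (intro finite_measure_mono) auto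
    also have "\<dots> \<le> (\<Sum>i. measure M (A i))"
      by (rule finite_measure_subadditive_countably[OF A_sets A_summable])
    also have "\<dots> \<le> (\<Sum>i. 3 * (N + 1) * K * (1/2) ^ j * (1 / real (i + 2) ^ 2))"
      using A A_summable sm by (intro suminf_le summable_mult)
    also have "\<dots> = 3 * (N + 1) * K * (1/2) ^ j * s" unfolding s_def by (rule suminf_mult[OF sm])
    finally show ?thesis by (simp add: mult_ac)
  qed
  moreover have "(\<lambda>j. (3 * (N + 1) * K * s) * (1/2) ^ j) \<longlonglongrightarrow> (3 * (N + 1) * K * s) * 0"
    by (intro tendsto_mult tendsto_const LIMSEQ_power_zero) simp
  ultimately have "measure M ?L \<le> 0"
    by (intro LIMSEQ_le_const[of _ 0]) auto
  then show ?thesis using measure_nonneg[of M ?L] by linarith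
qed

text \<open>The decay at infinity and the trivial bound 1 near the origin combine to a global power
  bound for the characteristic function. Then every bounded part of the Liouville set is null,
  although the measure is carried by that set.\<close>

lemma fast_decay_imp_not_decay_class:
  fixes f :: "real \<Rightarrow> real"
  assumes \<epsilon>: "\<epsilon> > 0" and fast: "\<forall>\<^sub>F \<xi> in at_top. f \<xi> < \<xi> powr (-\<epsilon>)"
  shows "f \<notin> decay_class Liouville_set"
proof
  assume "f \<in> decay_class Liouville_set"
  then obtain \<mu> c X where \<mu>: "\<mu> \<in> prob_on Liouville_set" and c: "c > 0"
    and bound: "\<And>\<xi>. \<bar>\<xi>\<bar> \<ge> X \<Longrightarrow> norm (fourier_meas \<mu> \<xi>) \<le> c * f \<bar>\<xi>\<bar>"
    by (auto simp: decay_class_def)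
  have prob: "prob_space \<mu>" and sets: "sets \<mu> = sets borel"
    and null: "emeasure \<mu> (UNIV - Liouville_set) = 0" using \<mu> by (auto simp: prob_on_def)
  interpret prob_space \<mu> by (rule prob)
  interpret real_distribution \<mu> by unfold_locales (rule sets)
  obtain Y where Y: "\<And>\<xi>. \<xi> \<ge> Y \<Longrightarrow> f \<xi> < \<xi> powr (-\<epsilon>)"
    using fast unfolding eventually_at_top_linorder by blast
  define \<alpha> where "\<alpha> = min \<epsilon> 1"
  have \<alpha>: "0 < \<alpha>" "\<alpha> \<le> 1" "\<alpha> \<le> \<epsilon>" using \<epsilon> by (auto simp: \<alpha>_def)
  define T where "T = 2 * pi * (\<bar>X\<bar> + \<bar>Y\<bar> + 1)"
  have T0: "T > 0" by (simp add: T_def add_nonneg_pos)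
  \<comment> \<open>The first term serves |t| \<le> T; the second serves |t| > T, where 1 + |t|
    \<le> 4 \<pi> |\<xi>|.\<close>
  define C where "C = (1 + T) powr \<alpha> + c * (4 * pi) powr \<alpha>"
  have "norm (char \<mu> t) \<le> C * (1 + \<bar>t\<bar>) powr (-\<alpha>)" for t
  proof -
    have "norm (char \<mu> t) * (1 + \<bar>t\<bar>) powr \<alpha> \<le> C"
    proof (cases "\<bar>t\<bar> \<le> T")
      case True
      have "norm (char \<mu> t) * (1 + \<bar>t\<bar>) powr \<alpha> \<le> 1 * (1 + T) powr \<alpha>"
        using True \<alpha> by (intro mult_mono cmod_char_le_1 powr_mono2) auto
      then show ?thesis using c by (simp add: C_def add_increasing2)
    next
      case False
      define \<xi> where "\<xi> = - t / (2 * pi)"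
      have t: "t = - 2 * pi * \<xi>" by (simp add: \<xi>_def)
      have abs_t: "\<bar>t\<bar> = 2 * pi * \<bar>\<xi>\<bar>" by (simp add: t abs_mult)
      have "2 * pi * (\<bar>X\<bar> + \<bar>Y\<bar> + 1) < 2 * pi * \<bar>\<xi>\<bar>" using False unfolding T_def abs_t by simp
      then have x: "\<bar>X\<bar> + \<bar>Y\<bar> + 1 < \<bar>\<xi>\<bar>" by simp
      then have "X \<le> \<bar>\<xi>\<bar>" "Y \<le> \<bar>\<xi>\<bar>" by linarith+
      have "norm (char \<mu> t) \<le> c * f \<bar>\<xi>\<bar>"
        using bound[of \<xi>] \<open>X \<le> \<bar>\<xi>\<bar>\<close> unfolding t fourier_meas_eq_char by simp
      also have "\<dots> \<le> c * \<bar>\<xi>\<bar> powr (-\<epsilon>)" using Y[OF \<open>Y \<le> \<bar>\<xi>\<bar>\<close>] c by (intro mult_left_mono) auto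
      also have "\<dots> \<le> c * \<bar>\<xi>\<bar> powr (-\<alpha>)" using x c \<alpha> by (intro mult_left_mono powr_mono) auto
      finally have "norm (char \<mu> t) * (1 + \<bar>t\<bar>) powr \<alpha> \<le> (c * \<bar>\<xi>\<bar> powr (-\<alpha>)) * (4 * pi * \<bar>\<xi>\<bar>) powr \<alpha>"
      proof (rule mult_mono)
        have "1 + \<bar>t\<bar> \<le> 4 * pi * \<bar>\<xi>\<bar>"
        proof -
          have "1 * 1 \<le> 2 * pi * \<bar>\<xi>\<bar>" using x pi_gt3 by (intro mult_mono) auto
          then show ?thesis unfolding abs_t by simp
        qed
        then show "(1 + \<bar>t\<bar>) powr \<alpha> \<le> (4 * pi * \<bar>\<xi>\<bar>) powr \<alpha>" using \<alpha> by (intro powr_mono2) auto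
      qed (use c in auto)
      also have "\<dots> = c * (4 * pi) powr \<alpha>"
        using x by (simp add: powr_mult powr_minus field_simps)
      finally show ?thesis using c by (simp add: C_def add_increasing)
    qed
    then show ?thesis by (simp add: powr_minus_divide field_simps)
  qed
  from measure_Icc_le_of_char_decay[OF \<alpha>(1,2) this]
  obtain K where K: "K \<ge> 0" "\<And>x r. 0 < r \<Longrightarrow> r \<le> 1/4 \<Longrightarrow> measure \<mu> {x - r..x + r} \<le> K * r powr (\<alpha>/2)"
    by blast
  have "measure \<mu> (Liouville_set \<inter> {- real N..real N}) = 0" for N
    by (rule Liouville_set_null[OF K]) (use \<alpha> in auto)
  then have "AE x in \<mu>. \<forall>N. x \<notin> Liouville_set \<inter> {- real N..real N}"
    unfolding AE_all_countable using Liouville_set_borel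
    by (intro allI AE_not_in null_setsI) (auto simp: emeasure_eq_measure sets)
  moreover have "AE x in \<mu>. x \<notin> UNIV - Liouville_set"
    using null Liouville_set_borel by (intro AE_not_in null_setsI) (auto simp: sets)
  ultimately have "AE x in \<mu>. False"
  proof eventually_elim
    case (elim x)
    obtain N :: nat where "\<bar>x\<bar> \<le> real N" using real_arch_simple by blast
    then have "x \<in> {- real N..real N}" by auto
    then show ?case using elim by blast
  qed
  then show False by simp
qed

section \<open>The asymptotic conditions\<close>

text \<open>From left to right the limsup is below 1. Conversely, the comparison with exponent
  \<alpha>/2 leaves a factor \<xi>^(-\<alpha>/2), which tends to 0.\<close>

lemma slow_decay_iff_Limsup_powr:
  fixes f :: "real \<Rightarrow> real"
  assumes pos: "\<And>x. x \<ge> 0 \<Longrightarrow> f x > 0"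
  shows "(\<forall>\<alpha>>0. Limsup at_top (\<lambda>\<xi>. ereal (\<xi> powr (-\<alpha>) / f \<xi>)) = 0) \<longleftrightarrow>
         (\<forall>\<epsilon>>0. \<forall>\<^sub>F \<xi> in at_top. \<xi> powr (-\<epsilon>) < f \<xi>)"
    (is "?L \<longleftrightarrow> ?R")
proof
  assume L: ?L
  show ?R
  proof (intro allI impI)
    fix \<epsilon> :: real assume "\<epsilon> > 0"
    then have "Limsup at_top (\<lambda>\<xi>. ereal (\<xi> powr (-\<epsilon>) / f \<xi>)) < ereal 1" using L by simp
    then have "\<forall>\<^sub>F \<xi> in at_top. ereal (\<xi> powr (-\<epsilon>) / f \<xi>) < ereal 1" by (rule Limsup_lessD)
    then show "\<forall>\<^sub>F \<xi> in at_top. \<xi> powr (-\<epsilon>) < f \<xi>"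
      using eventually_ge_at_top[of 0]
      by eventually_elim (use pos in \<open>auto simp: field_simps\<close>)
  qed
next
  assume R: ?R
  show ?L
  proof (intro allI impI)
    fix \<alpha> :: real assume a: "\<alpha> > 0"
    have "((\<lambda>\<xi>. \<xi> powr (-\<alpha>) / f \<xi>) \<longlongrightarrow> 0) at_top"
    proof (rule tendsto_sandwich)
      show "\<forall>\<^sub>F \<xi> in at_top. 0 \<le> \<xi> powr (-\<alpha>) / f \<xi>"
        using eventually_ge_at_top[of 0]
        by eventually_elim (use pos in \<open>auto intro!: divide_nonneg_pos\<close>)
      have "\<forall>\<^sub>F \<xi> in at_top. \<xi> powr (-(\<alpha>/2)) < f \<xi>" using R a by simp
      then show "\<forall>\<^sub>F \<xi> in at_top. \<xi> powr (-\<alpha>) / f \<xi> \<le> \<xi> powr (-(\<alpha>/2))"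
        using eventually_gt_at_top[of 0]
      proof eventually_elim
        case (elim \<xi>)
        have "\<xi> powr (-\<alpha>) = \<xi> powr (-(\<alpha>/2)) * \<xi> powr (-(\<alpha>/2))"
          by (simp flip: powr_add)
        also have "\<dots> \<le> \<xi> powr (-(\<alpha>/2)) * f \<xi>"
          using elim by (intro mult_left_mono) auto
        finally show ?case using pos[of \<xi>] elim by (simp add: field_simps)
      qed
      show "((\<lambda>\<xi>::real. \<xi> powr (-(\<alpha>/2))) \<longlongrightarrow> 0) at_top"
        using a by (intro tendsto_neg_powr filterlim_ident) auto
    qed auto
    then have "((\<lambda>\<xi>. ereal (\<xi> powr (-\<alpha>) / f \<xi>)) \<longlongrightarrow> ereal 0) at_top" by simp
    then show "Limsup at_top (\<lambda>\<xi>. ereal (\<xi> powr (-\<alpha>) / f \<xi>)) = 0"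
      by (simp add: lim_imp_Limsup zero_ereal_def)
  qed
qed

lemma neg_ln_quotient_less_iff:
  assumes "x > 1" "(y::real) > 0"
  shows "- ln y / ln x < e \<longleftrightarrow> x powr (-e) < y"
proof -
  have "- ln y / ln x < e \<longleftrightarrow> - e * ln x < ln y" using assms by (auto simp: field_simps)
  also have "\<dots> \<longleftrightarrow> x powr (-e) < y"
    using assms by (metis exp_less_cancel_iff exp_ln less_trans powr_def zero_less_one less_irrefl)
  finally show ?thesis .
qed

lemma less_neg_ln_quotient_iff:
  assumes "x > 1" "(y::real) > 0"
  shows "e < - ln y / ln x \<longleftrightarrow> y < x powr (-e)"
proof -
  have "e < - ln y / ln x \<longleftrightarrow> ln y < - e * ln x" using assms by (auto simp: field_simps)
  also have "\<dots> \<longleftrightarrow> y < x powr (-e)"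
    using assms by (metis exp_less_cancel_iff exp_ln less_trans powr_def zero_less_one less_irrefl)
  finally show ?thesis .
qed

text \<open>Boundedness of \<open>f\<close> makes the limsup nonnegative, because the quotient is at
  least -ln B / ln \<xi>, which tends to 0. Only the upper bound then has to be compared with the
  powers.\<close>

lemma slow_decay_iff_Limsup_exponent:
  fixes f :: "real \<Rightarrow> real"
  assumes pos: "\<And>x. x \<ge> 0 \<Longrightarrow> f x > 0"
    and bdd: "bounded (f ` {0..})"
  shows "Limsup at_top (\<lambda>\<xi>. ereal (- ln (f \<xi>) / ln \<xi>)) = 0 \<longleftrightarrow>
         (\<forall>\<epsilon>>0. \<forall>\<^sub>F \<xi> in at_top. \<xi> powr (-\<epsilon>) < f \<xi>)"
    (is "?L = 0 \<longleftrightarrow> ?R")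
proof -
  obtain B where B: "\<And>x. x \<ge> 0 \<Longrightarrow> f x \<le> B"
    using bdd unfolding bounded_iff by (metis abs_le_D1 atLeast_iff imageI real_norm_def)
  have B0: "B > 0" using B[of 0] pos[of 0] by simp
  have "((\<lambda>\<xi>. ereal (- ln B / ln \<xi>)) \<longlongrightarrow> ereal 0) at_top"
    by (intro tendsto_ereal tendsto_divide_0[OF tendsto_const] filterlim_at_top_imp_at_infinity ln_at_top)
  then have "Limsup at_top (\<lambda>\<xi>. ereal (- ln B / ln \<xi>)) = 0"
    by (simp add: lim_imp_Limsup zero_ereal_def)
  moreover have "\<forall>\<^sub>F \<xi> in at_top. ereal (- ln B / ln \<xi>) \<le> ereal (- ln (f \<xi>) / ln \<xi>)"
    using eventually_gt_at_top[of 1]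
  proof eventually_elim
    case (elim \<xi>)
    then have "ln (f \<xi>) \<le> ln B" using B[of \<xi>] pos[of \<xi>] by simp
    then show ?case using elim by (simp add: divide_right_mono)
  qed
  ultimately have ge: "?L \<ge> 0" using Limsup_mono by metis
  have "?L \<le> 0 \<longleftrightarrow> ?R"
  proof
    assume le: "?L \<le> 0"
    show ?R
    proof (intro allI impI)
      fix \<epsilon> :: real assume "\<epsilon> > 0"
      then have "?L < ereal \<epsilon>" using le by (metis ereal_less(2) le_less_trans)
      then have "\<forall>\<^sub>F \<xi> in at_top. ereal (- ln (f \<xi>) / ln \<xi>) < ereal \<epsilon>" by (rule Limsup_lessD)
      then show "\<forall>\<^sub>F \<xi> in at_top. \<xi> powr (-\<epsilon>) < f \<xi>"
        using eventually_gt_at_top[of 1]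
        by eventually_elim (use pos in \<open>simp add: neg_ln_quotient_less_iff[symmetric]\<close>)
    qed
  next
    assume R: ?R
    show "?L \<le> 0"
    proof (rule ereal_le_epsilon2)
      fix e :: real assume e: "e > 0"
      have "\<forall>\<^sub>F \<xi> in at_top. \<xi> powr (-e) < f \<xi>" using R e by blast
      then have "\<forall>\<^sub>F \<xi> in at_top. ereal (- ln (f \<xi>) / ln \<xi>) \<le> 0 + ereal e"
        using eventually_gt_at_top[of 1]
      proof eventually_elim
        case (elim \<xi>)
        have "- ln (f \<xi>) / ln \<xi> < e"
          using elim pos[of \<xi>] by (subst neg_ln_quotient_less_iff) auto
        then show ?case by simp
      qed
      then show "?L \<le> 0 + ereal e" by (rule Limsup_bounded)
    qed
  qed
  then show ?thesis using ge by (metis order_antisym order_refl)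
qed

lemma ereal_exists_between_zero:
  assumes "(0::ereal) < L"
  obtains e :: real where "e > 0" "ereal e < L"
  using ereal_dense2[OF assms] by (auto simp: zero_ereal_def)

lemma fast_decay_iff_Liminf_exponent:
  fixes f :: "real \<Rightarrow> real"
  assumes pos: "\<And>x. x \<ge> 0 \<Longrightarrow> f x > 0"
  shows "Liminf at_top (\<lambda>\<xi>. ereal (- ln (f \<xi>) / ln \<xi>)) > 0 \<longleftrightarrow>
         (\<exists>\<epsilon>>0. \<forall>\<^sub>F \<xi> in at_top. f \<xi> < \<xi> powr (-\<epsilon>))"
    (is "?L > 0 \<longleftrightarrow> ?R")
proof
  assume "?L > 0"
  then obtain e where e: "e > 0" "ereal e < ?L" by (rule ereal_exists_between_zero)
  have "\<forall>\<^sub>F \<xi> in at_top. ereal e < ereal (- ln (f \<xi>) / ln \<xi>)" using less_LiminfD[OF e(2)] .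
  then have "\<forall>\<^sub>F \<xi> in at_top. f \<xi> < \<xi> powr (-e)"
    using eventually_gt_at_top[of 1]
    by eventually_elim (use pos in \<open>simp add: less_neg_ln_quotient_iff[symmetric]\<close>)
  then show ?R using e by blast
next
  assume ?R
  then obtain e where e: "e > 0" "\<forall>\<^sub>F \<xi> in at_top. f \<xi> < \<xi> powr (-e)" by blast
  have "\<forall>\<^sub>F \<xi> in at_top. ereal e \<le> ereal (- ln (f \<xi>) / ln \<xi>)"
    using e(2) eventually_gt_at_top[of 1]
  proof eventually_elim
    case (elim \<xi>)
    have "e < - ln (f \<xi>) / ln \<xi>"
      using elim pos[of \<xi>] by (subst less_neg_ln_quotient_iff) auto
    then show ?case by simp
  qed
  then have "ereal e \<le> ?L" by (rule Liminf_bounded)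
  then show "?L > 0" using e(1) by (metis ereal_less(2) less_le_trans)
qed

text \<open>A positive liminf bounds \<open>f\<close> by a constant times a power; halving the
  exponent absorbs the constant.\<close>

lemma fast_decay_iff_Liminf_powr:
  fixes f :: "real \<Rightarrow> real"
  assumes pos: "\<And>x. x \<ge> 0 \<Longrightarrow> f x > 0"
  shows "(\<exists>\<alpha>>0. Liminf at_top (\<lambda>\<xi>. ereal (\<xi> powr (-\<alpha>) / f \<xi>)) > 0) \<longleftrightarrow>
         (\<exists>\<epsilon>>0. \<forall>\<^sub>F \<xi> in at_top. f \<xi> < \<xi> powr (-\<epsilon>))"
    (is "?L \<longleftrightarrow> ?R")
proof
  assume ?L
  then obtain \<alpha> where a: "\<alpha> > 0" and "Liminf at_top (\<lambda>\<xi>. ereal (\<xi> powr (-\<alpha>) / f \<xi>)) > 0"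
    by blast
  then obtain e where e: "e > 0" "ereal e < Liminf at_top (\<lambda>\<xi>. ereal (\<xi> powr (-\<alpha>) / f \<xi>))"
    using ereal_exists_between_zero by blast
  have 1: "\<forall>\<^sub>F \<xi> in at_top. ereal e < ereal (\<xi> powr (-\<alpha>) / f \<xi>)" using less_LiminfD[OF e(2)] .
  have "((\<lambda>\<xi>::real. \<xi> powr (-(\<alpha>/2))) \<longlongrightarrow> 0) at_top"
    using a by (intro tendsto_neg_powr filterlim_ident) auto
  then have "\<forall>\<^sub>F \<xi>::real in at_top. \<xi> powr (-(\<alpha>/2)) < e"
    using e(1) by (rule order_tendstoD)
  with 1 have "\<forall>\<^sub>F \<xi> in at_top. f \<xi> < \<xi> powr (-(\<alpha>/2))"
    using eventually_gt_at_top[of 0]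
  proof eventually_elim
    case (elim \<xi>)
    have "e * f \<xi> < \<xi> powr (-\<alpha>)" using elim pos[of \<xi>] by (simp add: field_simps)
    also have "\<xi> powr (-\<alpha>) = \<xi> powr (-(\<alpha>/2)) * \<xi> powr (-(\<alpha>/2))"
      by (simp flip: powr_add)
    also have "\<dots> \<le> e * \<xi> powr (-(\<alpha>/2))" using elim by (intro mult_right_mono) auto
    finally show ?case using e(1) by simp
  qed
  then show ?R using a half_gt_zero by blast
next
  assume ?R
  then obtain e where e: "e > 0" "\<forall>\<^sub>F \<xi> in at_top. f \<xi> < \<xi> powr (-e)" by blast
  have "\<forall>\<^sub>F \<xi> in at_top. ereal 1 \<le> ereal (\<xi> powr (-e) / f \<xi>)"
    using e(2) eventually_gt_at_top[of 0]
    by eventually_elim (use pos in \<open>auto simp: field_simps less_imp_le\<close>)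
  then have "ereal 1 \<le> Liminf at_top (\<lambda>\<xi>. ereal (\<xi> powr (-e) / f \<xi>))" by (rule Liminf_bounded)
  then have "Liminf at_top (\<lambda>\<xi>. ereal (\<xi> powr (-e) / f \<xi>)) > 0"
    by (metis ereal_less(2) less_le_trans zero_less_one)
  then show ?L using e(1) by blast
qed

text \<open>The substitution \<xi> = exp \<gamma>: the exponential function maps the filter
  \<open>at_top\<close> to itself.\<close>

lemma Limsup_exp_at_top: "Limsup at_top (\<lambda>x::real. g (exp x)) = Limsup at_top g"
  using Limsup_filtermap_eq[of exp at_top g] by (simp add: filtermap_exp_at_top inj_def)

lemma Liminf_exp_at_top: "Liminf at_top (\<lambda>x::real. g (exp x)) = Liminf at_top g"
  using Liminf_filtermap_eq[of exp at_top g] by (simp add: filtermap_exp_at_top inj_def)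

theorem theorem1p5:
  fixes f :: "real \<Rightarrow> real"
  assumes pos: "\<forall>x\<ge>0. f x > 0"
    and bdd: "bounded (f ` {0..})"
    and reg: "(\<forall>x y. 0 \<le> x \<and> x \<le> y \<longrightarrow> f y \<le> f x) \<or> continuous_on {0..} f"
  defines "\<tau> \<equiv> (\<lambda>\<xi>. - ln (f \<xi>) / ln \<xi>)"
    and "\<phi> \<equiv> (\<lambda>\<gamma>. - ln (f (exp \<gamma>)))"
  shows
    "((\<forall>\<alpha>>0. Limsup at_top (\<lambda>\<xi>. ereal (\<xi> powr (-\<alpha>) / f \<xi>)) = 0)
        \<longleftrightarrow> Limsup at_top (\<lambda>\<xi>. ereal (\<tau> \<xi>)) = 0)
     \<and> (Limsup at_top (\<lambda>\<xi>. ereal (\<tau> \<xi>)) = 0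
        \<longleftrightarrow> Limsup at_top (\<lambda>\<gamma>. ereal (\<phi> \<gamma> / \<gamma>)) = 0)
     \<and> ((\<forall>\<alpha>>0. Limsup at_top (\<lambda>\<xi>. ereal (\<xi> powr (-\<alpha>) / f \<xi>)) = 0)
        \<longrightarrow> f \<in> decay_class Liouville_set)
     \<and> ((\<exists>\<alpha>0>0. Liminf at_top (\<lambda>\<xi>. ereal (\<xi> powr (-\<alpha>0) / f \<xi>)) > 0)
        \<longleftrightarrow> Liminf at_top (\<lambda>\<xi>. ereal (\<tau> \<xi>)) > 0)
     \<and> (Liminf at_top (\<lambda>\<xi>. ereal (\<tau> \<xi>)) > 0
        \<longleftrightarrow> Liminf at_top (\<lambda>\<gamma>. ereal (\<phi> \<gamma> / \<gamma>)) > 0)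
     \<and> ((\<exists>\<alpha>0>0. Liminf at_top (\<lambda>\<xi>. ereal (\<xi> powr (-\<alpha>0) / f \<xi>)) > 0)
        \<longrightarrow> f \<notin> decay_class Liouville_set)"
proof -
  have f_pos: "\<And>x. x \<ge> 0 \<Longrightarrow> f x > 0" using pos by blast
  have "\<phi> \<gamma> / \<gamma> = \<tau> (exp \<gamma>)" for \<gamma> by (simp add: \<phi>_def \<tau>_def)
  then have c_iff_b: "Limsup at_top (\<lambda>\<gamma>. ereal (\<phi> \<gamma> / \<gamma>)) = Limsup at_top (\<lambda>\<xi>. ereal (\<tau> \<xi>))"
    and c'_iff_b': "Liminf at_top (\<lambda>\<gamma>. ereal (\<phi> \<gamma> / \<gamma>)) = Liminf at_top (\<lambda>\<xi>. ereal (\<tau> \<xi>))"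
    by (simp_all add: Limsup_exp_at_top[of "\<lambda>\<xi>. ereal (\<tau> \<xi>)"] Liminf_exp_at_top[of "\<lambda>\<xi>. ereal (\<tau> \<xi>)"])
  have "(\<forall>\<alpha>>0. Limsup at_top (\<lambda>\<xi>. ereal (\<xi> powr (-\<alpha>) / f \<xi>)) = 0) \<longleftrightarrow>
      (\<forall>\<epsilon>>0. \<forall>\<^sub>F \<xi> in at_top. \<xi> powr (-\<epsilon>) < f \<xi>)"
    by (rule slow_decay_iff_Limsup_powr[OF f_pos])
  moreover have "Limsup at_top (\<lambda>\<xi>. ereal (\<tau> \<xi>)) = 0 \<longleftrightarrow>
      (\<forall>\<epsilon>>0. \<forall>\<^sub>F \<xi> in at_top. \<xi> powr (-\<epsilon>) < f \<xi>)"
    unfolding \<tau>_def by (rule slow_decay_iff_Limsup_exponent[OF f_pos bdd])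
  moreover have "(\<exists>\<alpha>>0. Liminf at_top (\<lambda>\<xi>. ereal (\<xi> powr (-\<alpha>) / f \<xi>)) > 0) \<longleftrightarrow>
      (\<exists>\<epsilon>>0. \<forall>\<^sub>F \<xi> in at_top. f \<xi> < \<xi> powr (-\<epsilon>))"
    by (rule fast_decay_iff_Liminf_powr[OF f_pos])
  moreover have "Liminf at_top (\<lambda>\<xi>. ereal (\<tau> \<xi>)) > 0 \<longleftrightarrow>
      (\<exists>\<epsilon>>0. \<forall>\<^sub>F \<xi> in at_top. f \<xi> < \<xi> powr (-\<epsilon>))"
    unfolding \<tau>_def by (rule fast_decay_iff_Liminf_exponent[OF f_pos])
  moreover have "(\<forall>\<epsilon>>0. \<forall>\<^sub>F \<xi> in at_top. \<xi> powr (-\<epsilon>) < f \<xi>) \<longrightarrow> f \<in> decay_class Liouville_set"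
    using slow_decay_imp_decay_class[of f] by blast
  moreover have "(\<exists>\<epsilon>>0. \<forall>\<^sub>F \<xi> in at_top. f \<xi> < \<xi> powr (-\<epsilon>)) \<longrightarrow> f \<notin> decay_class Liouville_set"
    using fast_decay_imp_not_decay_class[of _ f] by blast
  ultimately show ?thesis unfolding c_iff_b c'_iff_b' by argo
qed

end
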